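(* Let $\mathcal{H}$ be a finite-dimensional complex Hilbert space, let $\rho$ be a density operator on $\mathcal{H}$ (positive semi-definite with $\operatorname{Tr}\rho=1$) and let $\sigma$ be a positive semi-definite operator on $\mathcal{H}$ with $\ker\sigma\subseteq\ker\rho$. Suppose $J$ is an open interval containing $1$, and $g:J\to\mathbb{R}$ is a continuously differentiable function with $g(1)\neq 0$. Then $$\lim_{\alpha\to 1} D_{\alpha,g(\alpha)}(\rho\|\sigma)=D(\rho\|\sigma)=\operatorname{Tr}\big(\rho(\log\rho-\log\sigma)\big).$$
   Context: For $\alpha\in\mathbb{R}\setminus\{1\}$ and $z\in\mathbb{R}\setminus\{0\}$, the $\alpha$-$z$ relative Rényi entropy is $$D_{\alpha,z}(\rho\|\sigma):=\frac{1}{\alpha-1}\log\operatorname{Tr}\Big(\big(\sigma^{\frac{1-\alpha}{2z}}\rho^{\frac{\alpha}{z}}\sigma^{\frac{1-\alpha}{2z}}\big)^z\Big).$$ Real powers (including negative ones) and logarithms of positive semi-definite operators are evaluated on their support (i.e. via the spectral decomposition restricted to nonzero eigenvalues, so e.g. $\rho^{-1}$ is the generalized inverse and $\log\rho$ is the logarithm on the support of $\rho$). $\log$ denotes the natural logarithm. *)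

theory Defs
  imports Complex_Main "Jordan_Normal_Form.Matrix" "Jordan_Normal_Form.Matrix_Kernel"
begin

definition adj :: "complex mat \<Rightarrow> complex mat" where
  "adj A = mat (dim_col A) (dim_row A) (\<lambda>(i,j). cnj (A $$ (j,i)))"

definition hermitian_mat :: "nat \<Rightarrow> complex mat \<Rightarrow> bool" where
  "hermitian_mat n A \<longleftrightarrow> A \<in> carrier_mat n n \<and> adj A = A"

definition psd_mat :: "nat \<Rightarrow> complex mat \<Rightarrow> bool" where
  "psd_mat n A \<longleftrightarrow> hermitian_mat n A \<and>
     (\<forall>v \<in> carrier_vec n. 0 \<le> Re (\<Sum>i<n. cnj (v $ i) * (A *\<^sub>v v) $ i))"

definition mtrace :: "complex mat \<Rightarrow> complex" where
  "mtrace A = (\<Sum>i<dim_row A. A $$ (i,i))"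

definition density_mat :: "nat \<Rightarrow> complex mat \<Rightarrow> bool" where
  "density_mat n A \<longleftrightarrow> psd_mat n A \<and> mtrace A = 1"

definition unitary_mat :: "nat \<Rightarrow> complex mat \<Rightarrow> bool" where
  "unitary_mat n U \<longleftrightarrow> U \<in> carrier_mat n n \<and> U * adj U = 1\<^sub>m n \<and> adj U * U = 1\<^sub>m n"

definition real_diag :: "nat \<Rightarrow> (nat \<Rightarrow> real) \<Rightarrow> complex mat" where
  "real_diag n d = mat n n (\<lambda>(i,j). if i = j then complex_of_real (d i) else 0)"

definition mat_fun :: "nat \<Rightarrow> (real \<Rightarrow> real) \<Rightarrow> complex mat \<Rightarrow> complex mat" where
  "mat_fun n f A = (SOME B. \<exists>U d. unitary_mat n U \<and> A = U * real_diag n d * adj U \<and>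
                        B = U * real_diag n (\<lambda>i. f (d i)) * adj U)"

text \<open>Real powers and logarithm evaluated on the support (zero eigenvalues are mapped to 0).\<close>
definition supp_pow :: "real \<Rightarrow> real \<Rightarrow> real" where
  "supp_pow t x = (if x > 0 then x powr t else 0)"

definition supp_ln :: "real \<Rightarrow> real" where
  "supp_ln x = (if x > 0 then ln x else 0)"

definition mpow :: "nat \<Rightarrow> complex mat \<Rightarrow> real \<Rightarrow> complex mat" where
  "mpow n A t = mat_fun n (supp_pow t) A"

definition mlog :: "nat \<Rightarrow> complex mat \<Rightarrow> complex mat" where
  "mlog n A = mat_fun n supp_ln A"

definition alpha_z_renyi :: "nat \<Rightarrow> real \<Rightarrow> real \<Rightarrow> complex mat \<Rightarrow> complex mat \<Rightarrow> real" where
  "alpha_z_renyi n \<alpha> z \<rho> \<sigma> =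
     (1 / (\<alpha> - 1)) * ln (Re (mtrace (mpow n
        (mpow n \<sigma> ((1 - \<alpha>) / (2 * z)) * mpow n \<rho> (\<alpha> / z) * mpow n \<sigma> ((1 - \<alpha>) / (2 * z))) z)))"

definition umegaki :: "nat \<Rightarrow> complex mat \<Rightarrow> complex mat \<Rightarrow> real" where
  "umegaki n \<rho> \<sigma> = Re (mtrace (\<rho> * (mlog n \<rho> - mlog n \<sigma>)))"

end

theory Submission
  imports Defs "Jordan_Normal_Form.Schur_Decomposition" "Jordan_Normal_Form.Spectral_Radius"
begin

text \<open>
  Put \<open>M(\<alpha>) = \<sigma>^((1-\<alpha>)/2z) \<rho>^(\<alpha>/z) \<sigma>^((1-\<alpha>)/2z)\<close> with \<open>z = g(\<alpha>)\<close>. The kernel condition gives \<open>M(1) = \<rho>^(1/g(1))\<close>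
  and also \<open>M Q M = M\<close>, where \<open>Q\<close> is the same product with negated exponents. As \<open>Q\<close> stays bounded near
  \<open>\<alpha> = 1\<close>, the nonzero eigenvalues of \<open>M(\<alpha>)\<close> stay in a compact subset of the positive half line. On such
  spectra the scalar Taylor estimate for \<open>x^z\<close> (with \<open>0^z = 0\<close>) is uniform in \<open>z\<close>, also between zero and
  nonzero arguments, and it lifts to traces:
  \<open>Tr f(A) = Tr f(B) + Tr f'(B)(A - B) + O(norm (A - B)^2)\<close>, with no condition on commutation. With
  \<open>A = M(\<alpha>)\<close> and \<open>B = M(1)\<close> this yields the derivative of \<open>\<alpha> \<mapsto> Tr M(\<alpha>)^g(\<alpha>)\<close> at \<open>1\<close>; the contributions of
  \<open>g'(1)\<close> cancel, and the derivative is the relative entropy.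
\<close>

declare index_mult_mat(1) [simp del]


section \<open>Spectral theorem for Hermitian matrices\<close>

lemma adj_carrier_mat [simp]: "A \<in> carrier_mat n m \<Longrightarrow> adj A \<in> carrier_mat m n"
  unfolding adj_def by auto

lemma adj_index: "A \<in> carrier_mat n m \<Longrightarrow> i < m \<Longrightarrow> j < n \<Longrightarrow> adj A $$ (i,j) = cnj (A $$ (j,i))"
  unfolding adj_def by auto

text \<open>The sum form suits the entrywise arguments below. It is applied on demand, since
  products must mostly stay intact for reassociation.\<close>

lemma mult_mat_index:
  "A \<in> carrier_mat n m \<Longrightarrow> B \<in> carrier_mat m l \<Longrightarrow> i < n \<Longrightarrow> j < l \<Longrightarrow>
   (A * B) $$ (i,j) = (\<Sum>k<m. A $$ (i,k) * B $$ (k,j))"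
  by (auto simp: index_mult_mat(1) scalar_prod_def lessThan_atLeast0)

lemma adj_mult:
  assumes "A \<in> carrier_mat n m" "B \<in> carrier_mat m l"
  shows "adj (A * B) = adj B * adj A"
proof (rule eq_matI)
  fix i j assume "i < dim_row (adj B * adj A)" "j < dim_col (adj B * adj A)"
  then have ij: "i < l" "j < n"
    using assms by (auto simp: adj_def)
  show "adj (A * B) $$ (i, j) = (adj B * adj A) $$ (i, j)"
    using assms ij
    by (simp add: adj_index[of _ n l] mult_mat_index[of _ n m _ l] mult_mat_index[of _ l m _ n]
        adj_index[of _ n m] adj_index[of _ m l] mult.commute del: index_mult_mat)
qed (use assms in \<open>auto simp: adj_def\<close>)

lemma mult_carrier_mat_square [simp]:
  "A \<in> carrier_mat n n \<Longrightarrow> B \<in> carrier_mat n n \<Longrightarrow> A * B \<in> carrier_mat n n"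
  by (rule mult_carrier_mat)

lemmas assoc_mult_mat_square = assoc_mult_mat[of _ n n _ n _ n for n]
lemmas adj_mult_square = adj_mult[of _ n n _ n for n]

lemma adj_adj [simp]: "adj (adj A) = A"
  by (rule eq_matI) (auto simp: adj_def)

lemma real_diag_carrier_mat [simp]: "real_diag n d \<in> carrier_mat n n"
  unfolding real_diag_def by auto

lemma adj_real_diag [simp]: "adj (real_diag n d) = real_diag n d"
  by (rule eq_matI) (auto simp: adj_def real_diag_def)

lemma unitary_matD:
  assumes "unitary_mat n U"
  shows "U \<in> carrier_mat n n" "adj U \<in> carrier_mat n n" "U * adj U = 1\<^sub>m n" "adj U * U = 1\<^sub>m n"
  using assms unfolding unitary_mat_def by auto

lemma unitary_mat_adj: "unitary_mat n U \<Longrightarrow> unitary_mat n (adj U)"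
  unfolding unitary_mat_def by auto

lemma unitary_mat_mult:
  assumes U: "unitary_mat n U" and V: "unitary_mat n V"
  shows "unitary_mat n (U * V)"
proof -
  note u = unitary_matD[OF U] and v = unitary_matD[OF V]
  have "U * V * (adj V * adj U) = U * (V * adj V) * adj U"
    using u(1,2) v(1,2) by (simp add: assoc_mult_mat_square[where n="n"])
  moreover have "adj V * adj U * (U * V) = adj V * (adj U * U) * V"
    using u(1,2) v(1,2) by (simp add: assoc_mult_mat_square[where n="n"])
  ultimately show ?thesis
    using u v unfolding unitary_mat_def by (simp add: adj_mult_square[where n="n"])
qed

lemma left_inverse_unitary_mat:
  assumes "U \<in> carrier_mat n n" "adj U * U = 1\<^sub>m n"
  shows "unitary_mat n U"
  using assms mat_mult_left_right_inverse[of "adj U" n U] by (simp add: unitary_mat_def)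

text \<open>A spectral form when \<open>U\<close> is unitary. Unitarity is left to the lemmas
  because \<open>congruence_eigenvalue_nonneg\<close> works with a general factor in this
  place.\<close>

definition udiag :: "nat \<Rightarrow> complex mat \<Rightarrow> (nat \<Rightarrow> real) \<Rightarrow> complex mat" where
  "udiag n U d = U * real_diag n d * adj U"

lemma udiag_carrier_mat [simp]: "U \<in> carrier_mat n n \<Longrightarrow> udiag n U d \<in> carrier_mat n n"
  unfolding udiag_def by (auto intro!: mult_carrier_mat[of _ n n])

lemma mult_real_diag_index:
  "U \<in> carrier_mat n n \<Longrightarrow> i < n \<Longrightarrow> j < n \<Longrightarrow> (U * real_diag n d) $$ (i,j) = U $$ (i,j) * of_real (d j)"
  by (subst mult_mat_index[of _ n n _ n]) (auto simp: real_diag_def if_distrib cong: if_cong)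

lemma real_diag_mult_index:
  "U \<in> carrier_mat n n \<Longrightarrow> i < n \<Longrightarrow> j < n \<Longrightarrow> (real_diag n d * U) $$ (i,j) = of_real (d i) * U $$ (i,j)"
  by (subst mult_mat_index[of _ n n _ n]) (auto simp: real_diag_def if_distrib if_distribR cong: if_cong)

lemma udiag_index:
  assumes "U \<in> carrier_mat n n" "i < n" "j < n"
  shows "udiag n U d $$ (i,j) = (\<Sum>k<n. U $$ (i,k) * of_real (d k) * cnj (U $$ (j,k)))"
  using assms unfolding udiag_def
  by (subst mult_mat_index[of _ n n _ n])
     (auto simp: mult_real_diag_index adj_index[of _ n n] simp del: index_mult_mat
       intro!: mult_carrier_mat[of _ n n])

lemma adj_udiag: "U \<in> carrier_mat n n \<Longrightarrow> adj (udiag n U d) = udiag n U d"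
  unfolding udiag_def
  by (simp add: adj_mult_square[where n="n"] assoc_mult_mat_square[where n="n"])

text \<open>Extend \<open>v\<close> to a basis and orthogonalise: Gram-Schmidt leaves the first
  vector unchanged, and scaling all vectors to length one gives the columns of \<open>W\<close>. The
  factor \<open>c\<close> is the inverse length of \<open>v\<close>.\<close>

lemma unitary_mat_first_col:
  assumes v: "v \<in> carrier_vec n" and v0: "v \<noteq> 0\<^sub>v n"
  shows "\<exists>W c. unitary_mat n W \<and> c \<noteq> 0 \<and> (\<forall>i<n. W $$ (i,0) = c * v $ i)"
proof -
  interpret cof_vec_space n "TYPE(complex)" .
  have n: "n > 0"
    using v v0 by (cases n) auto
  define b where "b = basis_completion v"
  from basis_completion[OF v v0, folded b_def]
  have dist_b: "distinct b"
    and indep: "\<not> lin_dep (set b)" and b: "set b \<subseteq> carrier_vec n" and hdb: "hd b = v"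
    and len_b: "length b = n" by auto
  from hdb len_b n obtain vs where bv: "b = v # vs" by (cases b, auto)
  define ws where "ws = gram_schmidt n b"
  from gram_schmidt_result[OF b dist_b indep refl, folded ws_def]
  have ws: "set ws \<subseteq> carrier_vec n" "corthogonal ws" "length ws = n"
    by (auto simp: len_b)
  from gram_schmidt_hd[OF v, of vs, folded bv] have hdws: "hd ws = v" unfolding ws_def .
  then have ws0: "ws ! 0 = v"
    using ws(3) n by (cases ws) auto
  have wsc: "ws ! j \<in> carrier_vec n" if "j < n" for j
    using ws that by auto
  have ip: "ws ! j \<bullet>c ws ! i = (\<Sum>k<n. ws ! j $ k * cnj (ws ! i $ k))" if "i < n" "j < n" for i j
    using wsc[OF that(1)] wsc[OF that(2)] by (auto simp: scalar_prod_def lessThan_atLeast0)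
  \<comment> \<open>Squared lengths, needed because \<open>gram_schmidt\<close> returns orthogonal
    vectors that are not normalised.\<close>
  define N where "N j = (\<Sum>k<n. (cmod (ws ! j $ k))\<^sup>2)" for j
  have N: "ws ! j \<bullet>c ws ! j = of_real (N j)" if "j < n" for j
    unfolding ip[OF that that] N_def by (simp only: complex_norm_square of_real_sum)
  have Npos: "N j > 0" if "j < n" for j
  proof -
    have "N j \<noteq> 0"
      using N[OF that] corthogonalD[OF ws(2)] that ws(3) by fastforce
    moreover have "N j \<ge> 0"
      unfolding N_def by (intro sum_nonneg) auto
    ultimately show ?thesis by simp
  qed
  define W where "W = mat n n (\<lambda>(i,j). ws ! j $ i / of_real (sqrt (N j)))"
  have W: "W \<in> carrier_mat n n"
    unfolding W_def by simp
  have "adj W * W = 1\<^sub>m n"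
  proof (rule eq_matI)
    fix i j assume "i < dim_row (1\<^sub>m n :: complex mat)" "j < dim_col (1\<^sub>m n :: complex mat)"
    then have ij: "i < n" "j < n" by auto
    have "(adj W * W) $$ (i,j) =
        (\<Sum>k<n. ws ! j $ k * cnj (ws ! i $ k)) / of_real (sqrt (N i) * sqrt (N j))"
      using ij W
      by (subst mult_mat_index[of _ n n _ n])
         (auto simp: adj_index[of _ n n] W_def sum_divide_distrib mult.commute)
    also have "\<dots> = (if i = j then 1 else 0)"
    proof (cases "i = j")
      case True
      have "of_real (sqrt (N j) * sqrt (N j)) = (of_real (N j) :: complex)"
        using Npos[OF ij(2)] by simp
      then show ?thesis
        using True ip[OF ij] N[OF ij(2)] Npos[OF ij(2)] by (metis divide_self_if less_irrefl of_real_eq_0_iff)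
    next
      case False
      then show ?thesis
        using ip[OF ij] corthogonalD[OF ws(2), of j i] ij ws(3) by simp
    qed
    finally show "(adj W * W) $$ (i,j) = 1\<^sub>m n $$ (i,j)"
      using ij by simp
  qed (use W in \<open>auto simp: adj_def\<close>)
  then have "unitary_mat n W"
    using left_inverse_unitary_mat W by blast
  moreover have "\<forall>i<n. W $$ (i,0) = (1 / of_real (sqrt (N 0))) * v $ i"
    using n by (auto simp: W_def ws0)
  moreover have "1 / complex_of_real (sqrt (N 0)) \<noteq> 0"
    using Npos[OF n] by simp
  ultimately show ?thesis by blast
qed

lemma udiag_conj:
  assumes "W \<in> carrier_mat n n" "V \<in> carrier_mat n n"
  shows "W * udiag n V d * adj W = udiag n (W * V) d"
  using assms unfolding udiag_def
  by (simp add: adj_mult_square[where n="n"] assoc_mult_mat_square[where n="n"])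

text \<open>Deflation by induction on the dimension: put an eigenvector into the first column of a
  unitary \<open>W\<close>. In the new basis the first column is a multiple of the first unit
  vector, hermiticity gives the same for the first row, and the remaining block is again
  Hermitian.\<close>

lemma hermitian_mat_udiag:
  assumes "hermitian_mat n A"
  shows "\<exists>U d. unitary_mat n U \<and> A = udiag n U d"
  using assms
proof (induction n arbitrary: A)
  case 0
  then show ?case
    by (intro exI[of _ "1\<^sub>m 0"] exI[of _ "\<lambda>_. 0"])
       (auto simp: hermitian_mat_def unitary_mat_def udiag_def adj_def)
next
  case (Suc n)
  let ?m = "Suc n"
  have A: "A \<in> carrier_mat ?m ?m" and hA: "adj A = A"
    using Suc.prems by (auto simp: hermitian_mat_def)
  obtain e where "eigenvalue A e"
    using spectrum_non_empty[OF A] by (auto simp: spectrum_def)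
  then obtain v where v: "v \<in> carrier_vec ?m" "v \<noteq> 0\<^sub>v ?m" and Av: "A *\<^sub>v v = e \<cdot>\<^sub>v v"
    using A by (auto simp: eigenvalue_def eigenvector_def)
  obtain W c where W: "unitary_mat ?m W" and c: "c \<noteq> 0" "\<forall>i<?m. W $$ (i,0) = c * v $ i"
    using unitary_mat_first_col[OF v] by blast
  note w = unitary_matD[OF W]
  define B where "B = adj W * A * W"
  have B: "B \<in> carrier_mat ?m ?m"
    unfolding B_def using A w by auto
  have hB: "adj B = B"
    unfolding B_def using A w hA
    by (simp add: adj_mult_square[where n="?m"] assoc_mult_mat_square[where n="?m"])
  have AW: "(A * W) $$ (i,0) = e * W $$ (i,0)" if "i < ?m" for i
  proof -
    have "(A * W) $$ (i,0) = c * (A *\<^sub>v v) $ i"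
      using that A w v c
      by (subst mult_mat_index[of _ ?m ?m _ ?m])
         (auto simp: scalar_prod_def lessThan_atLeast0 sum_distrib_left distrib_left ac_simps intro!: sum.cong)
    then show ?thesis
      using that v c by (simp add: Av)
  qed
  have B0: "B $$ (i,0) = (if i = 0 then e else 0)" if "i < ?m" for i
  proof -
    have "B $$ (i,0) = (adj W * (A * W)) $$ (i,0)"
      unfolding B_def using A w by (simp add: assoc_mult_mat_square[where n="?m"])
    also have "\<dots> = (\<Sum>k<?m. adj W $$ (i,k) * (e * W $$ (k,0)))"
      using that A w AW by (subst mult_mat_index[of _ ?m ?m _ ?m]) (auto simp del: index_mult_mat)
    also have "\<dots> = e * (adj W * W) $$ (i,0)"
      using that A w AW
      by (subst mult_mat_index[of _ ?m ?m _ ?m])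
         (auto simp: sum_distrib_left ac_simps simp del: index_mult_mat sum.lessThan_Suc)
    finally show ?thesis
      using that by (simp add: w(4))
  qed
  have Bsym: "B $$ (i,j) = cnj (B $$ (j,i))" if "i < ?m" "j < ?m" for i j
    using adj_index[OF B, of i j] that hB by simp
  \<comment> \<open>A diagonal entry of a Hermitian matrix equals its own conjugate, so the
    eigenvalue is real.\<close>
  have e: "e = of_real (Re e)"
    using Bsym[of 0 0] B0[of 0] by (simp add: complex_eq_iff)
  define A' where "A' = mat n n (\<lambda>(i,j). B $$ (Suc i, Suc j))"
  have "hermitian_mat n A'"
    unfolding hermitian_mat_def
    by (auto simp: A'_def adj_def Bsym[of "Suc _" "Suc _", symmetric] intro!: eq_matI)
  then obtain U d where U: "unitary_mat n U" and A': "A' = udiag n U d"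
    using Suc.IH by blast
  note u = unitary_matD[OF U]
  \<comment> \<open>Block-diagonal extension of \<open>U\<close> by a single entry 1; accordingly
    \<open>d'\<close> prepends the eigenvalue.\<close>
  define V where "V = mat ?m ?m (\<lambda>(i,j). case i of 0 \<Rightarrow> (if j = 0 then 1 else 0) |
      Suc i' \<Rightarrow> (case j of 0 \<Rightarrow> 0 | Suc j' \<Rightarrow> U $$ (i',j')))"
  define d' where "d' = case_nat (Re e) d"
  have V: "V \<in> carrier_mat ?m ?m"
    by (simp add: V_def)
  have "adj V * V = 1\<^sub>m ?m"
  proof (rule eq_matI)
    fix i j assume "i < dim_row (1\<^sub>m ?m :: complex mat)" "j < dim_col (1\<^sub>m ?m :: complex mat)"
    then have ij: "i < ?m" "j < ?m" by auto
    have UU: "(\<Sum>k<n. cnj (U $$ (k,i')) * U $$ (k,j')) = (if i' = j' then 1 else 0)"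
      if "i' < n" "j' < n" for i' j'
    proof -
      have "(\<Sum>k<n. cnj (U $$ (k,i')) * U $$ (k,j')) = (adj U * U) $$ (i',j')"
        using that u by (subst mult_mat_index[of _ n n _ n]) (auto simp: adj_index[of _ n n])
      then show ?thesis
        using that u by simp
    qed
    have "(adj V * V) $$ (i,j) = (\<Sum>k<?m. cnj (V $$ (k,i)) * V $$ (k,j))"
      using ij V by (subst mult_mat_index[of _ ?m ?m _ ?m]) (auto simp: adj_index[of _ ?m ?m])
    also have "\<dots> = (if i = j then 1 else 0)"
      using ij UU unfolding sum.lessThan_Suc_shift
      by (cases i; cases j) (auto simp: V_def)
    finally show "(adj V * V) $$ (i,j) = 1\<^sub>m ?m $$ (i,j)"
      using ij by simp
  qed (use V in \<open>auto simp: adj_def\<close>)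
  then have uV: "unitary_mat ?m V"
    using left_inverse_unitary_mat V by blast
  have "B = udiag ?m V d'"
  proof (rule eq_matI)
    fix i j assume "i < dim_row (udiag ?m V d')" "j < dim_col (udiag ?m V d')"
    then have ij: "i < ?m" "j < ?m"
      using carrier_matD[OF udiag_carrier_mat[OF V, of d']] by auto
    have "udiag ?m V d' $$ (i,j) = (\<Sum>k<?m. V $$ (i,k) * of_real (d' k) * cnj (V $$ (j,k)))"
      using ij V by (rule_tac udiag_index) auto
    also have "\<dots> = B $$ (i,j)"
    proof (cases "i = 0 \<or> j = 0")
      case True
      then show ?thesis
        using ij B0 Bsym[of 0 j] e unfolding sum.lessThan_Suc_shift
        by (cases i; cases j) (auto simp: V_def d'_def)
    next
      case False
      then obtain i' j' where ij': "i = Suc i'" "j = Suc j'"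
        by (meson not0_implies_Suc)
      have "B $$ (i,j) = udiag n U d $$ (i',j')"
        using ij by (simp add: ij' A'_def flip: A')
      also have "\<dots> = (\<Sum>k<n. U $$ (i',k) * of_real (d k) * cnj (U $$ (j',k)))"
        using ij u by (intro udiag_index) (auto simp: ij')
      finally show ?thesis
        using ij unfolding sum.lessThan_Suc_shift by (simp add: V_def ij' d'_def)
    qed
    finally show "B $$ (i,j) = udiag ?m V d' $$ (i,j)" by simp
  qed (use B carrier_matD[OF udiag_carrier_mat[OF V, of d']] in auto)
  moreover have "A = W * B * adj W"
  proof -
    have "W * B * adj W = (W * adj W) * A * (W * adj W)"
      unfolding B_def using A w(1,2) by (simp add: assoc_mult_mat_square[where n="?m"])
    then show ?thesis
      using A w by simp
  qed
  ultimately have "A = udiag ?m (W * V) d'"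
    using w V by (simp add: udiag_conj)
  then show ?case
    using unitary_mat_mult[OF W uV] by blast
qed


section \<open>Functional calculus and traces\<close>

text \<open>Two spectral forms interact only through the overlap matrix \<open>adj U * V\<close>,
  whose entries are the inner products of their eigenvectors.\<close>

lemma udiag_mult_udiag:
  assumes U: "unitary_mat n U" and V: "unitary_mat n V"
  shows "udiag n U h * udiag n V k = U * (real_diag n h * (adj U * V) * real_diag n k) * adj V"
  using unitary_matD[OF U] unitary_matD[OF V] unfolding udiag_def
  by (simp add: assoc_mult_mat_square[where n=n])

lemma sandwich_index:
  assumes "X \<in> carrier_mat n n" "i < n" "j < n"
  shows "(real_diag n h * X * real_diag n k) $$ (i,j) = of_real (h i) * X $$ (i,j) * of_real (k j)"
  using assms mult_real_diag_index[of "real_diag n h * X" n i j k]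
  by (simp add: real_diag_mult_index del: index_mult_mat)

text \<open>Entry (i,j) of the middle factor is the overlap scaled by \<open>h i * k j\<close>, so
  pairs of orthogonal eigenvectors impose no condition.\<close>

lemma udiag_mult_udiag_cong:
  assumes U: "unitary_mat n U" and V: "unitary_mat n V"
    and eq: "\<And>i j. i < n \<Longrightarrow> j < n \<Longrightarrow> (adj U * V) $$ (i,j) \<noteq> 0 \<Longrightarrow> h i * k j = h' i * k' j"
  shows "udiag n U h * udiag n V k = udiag n U h' * udiag n V k'"
proof -
  note u = unitary_matD[OF U] and v = unitary_matD[OF V]
  have "real_diag n h * (adj U * V) * real_diag n k = real_diag n h' * (adj U * V) * real_diag n k'"
  proof (rule eq_matI)
    fix i j
    assume "i < dim_row (real_diag n h' * (adj U * V) * real_diag n k')"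
      "j < dim_col (real_diag n h' * (adj U * V) * real_diag n k')"
    then have ij: "i < n" "j < n"
      by (auto simp: real_diag_def)
    show "(real_diag n h * (adj U * V) * real_diag n k) $$ (i,j) =
      (real_diag n h' * (adj U * V) * real_diag n k') $$ (i,j)"
    proof (cases "(adj U * V) $$ (i,j) = 0")
      case False
      then have "complex_of_real (h i * k j) = complex_of_real (h' i * k' j)"
        using eq ij by simp
      then show ?thesis
        using ij u v sandwich_index[of "adj U * V" n i j] by simp
    qed (use ij u v sandwich_index[of "adj U * V" n i j] in simp)
  qed (auto simp: real_diag_def)
  then show ?thesis
    by (simp add: udiag_mult_udiag[OF U V])
qed

lemma udiag_mult:
  assumes U: "unitary_mat n U"
  shows "udiag n U h * udiag n U k = udiag n U (\<lambda>i. h i * k i)"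
proof -
  note u = unitary_matD[OF U]
  have "real_diag n h * (adj U * U) * real_diag n k = real_diag n (\<lambda>i. h i * k i)"
    by (rule eq_matI)
      (use u sandwich_index[of "1\<^sub>m n" n] in \<open>auto simp: real_diag_def simp del: index_mult_mat(1)\<close>)
  then show ?thesis
    unfolding udiag_mult_udiag[OF U U] by (simp add: udiag_def)
qed

lemma udiag_one:
  assumes U: "unitary_mat n U"
  shows "udiag n U (\<lambda>_. 1) = 1\<^sub>m n"
proof -
  note u = unitary_matD[OF U]
  have "real_diag n (\<lambda>_. 1) = 1\<^sub>m n"
    by (rule eq_matI) (auto simp: real_diag_def)
  then show ?thesis
    using u by (simp add: udiag_def)
qed

lemma udiag_cong: "(\<And>i. i < n \<Longrightarrow> h i = k i) \<Longrightarrow> udiag n U h = udiag n U k"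
  unfolding udiag_def real_diag_def by (intro arg_cong2[of _ _ _ _ "(*)"] refl cong_mat) auto

lemma unitary_conj_udiag:
  assumes "unitary_mat n U"
  shows "adj U * udiag n U d * U = real_diag n d"
proof -
  note u = unitary_matD[OF assms]
  have "adj U * udiag n U d * U = (adj U * U) * real_diag n d * (adj U * U)"
    unfolding udiag_def using u(1,2) by (simp add: assoc_mult_mat_square[where n=n])
  then show ?thesis
    by (simp add: u left_mult_one_mat[of _ n n] right_mult_one_mat[of _ n n])
qed

text \<open>The matrix \<open>adj U * V\<close> only connects equal eigenvalues, so it intertwines \<open>f\<close> of both diagonals.\<close>
lemma udiag_fun_cong:
  assumes U: "unitary_mat n U" and V: "unitary_mat n V"
    and eq: "udiag n U d = udiag n V e"
  shows "udiag n U (\<lambda>i. f (d i)) = udiag n V (\<lambda>i. f (e i))"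
proof -
  note u = unitary_matD[OF U] and v = unitary_matD[OF V]
  \<comment> \<open>Inserting \<open>U * adj U\<close> and then \<open>V * adj V\<close> trades one
    decomposition for the other.\<close>
  have "real_diag n d * (adj U * V) = adj U * udiag n U d * (U * adj U) * V"
    unfolding unitary_conj_udiag[OF U, symmetric]
    using u(1,2) v(1,2) by (simp add: assoc_mult_mat_square[where n=n])
  also have "\<dots> = adj U * udiag n U d * V"
    using u(1,2) by (simp add: u(3) right_mult_one_mat[of _ n n])
  also have "\<dots> = adj U * (V * adj V) * udiag n V e * V"
    using u(1,2) by (simp add: v(3) eq right_mult_one_mat[of _ n n])
  also have "\<dots> = (adj U * V) * real_diag n e"
    unfolding unitary_conj_udiag[OF V, symmetric]
    using u(1,2) v(1,2) by (simp add: assoc_mult_mat_square[where n=n])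
  finally have comm: "real_diag n d * (adj U * V) = (adj U * V) * real_diag n e" .
  have "d i = e j" if ij: "i < n" "j < n" "(adj U * V) $$ (i,j) \<noteq> 0" for i j
  proof -
    have "of_real (d i) * (adj U * V) $$ (i,j) = (adj U * V) $$ (i,j) * of_real (e j)"
      using ij u v arg_cong[OF comm, of "\<lambda>A. A $$ (i,j)"]
      by (simp add: real_diag_mult_index mult_real_diag_index del: index_mult_mat)
    then show ?thesis
      using ij(3) by (simp add: mult.commute)
  qed
  \<comment> \<open>The constant diagonal 1 gives the identity. The claim thus becomes an equality
    of two products, where only overlapping eigenvectors count.\<close>
  then have "udiag n U (\<lambda>i. f (d i)) * udiag n V (\<lambda>_. 1) = udiag n U (\<lambda>_. 1) * udiag n V (\<lambda>i. f (e i))"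
    by (intro udiag_mult_udiag_cong[OF U V]) auto
  then show ?thesis
    using u v by (simp add: udiag_one[OF U] udiag_one[OF V] right_mult_one_mat[of _ n n] left_mult_one_mat[of _ n n])
qed

text \<open>\<open>mat_fun\<close> picks an arbitrary decomposition; \<open>udiag_fun_cong\<close>
  makes the result independent of the pick.\<close>

lemma mat_fun_udiag:
  assumes U: "unitary_mat n U"
  shows "mat_fun n f (udiag n U d) = udiag n U (\<lambda>i. f (d i))"
proof -
  let ?P = "\<lambda>B. \<exists>V e. unitary_mat n V \<and> udiag n U d = udiag n V e \<and> B = udiag n V (\<lambda>i. f (e i))"
  have "?P (mat_fun n f (udiag n U d))"
    unfolding mat_fun_def udiag_def[symmetric] by (rule someI_ex) (use U in blast)
  then show ?thesis
    using udiag_fun_cong[OF U] by metis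
qed

section \<open>Traces in two orthonormal bases\<close>

lemma mtrace_mult:
  assumes "A \<in> carrier_mat n n" "B \<in> carrier_mat n n"
  shows "mtrace (A * B) = (\<Sum>i<n. \<Sum>j<n. A $$ (i,j) * B $$ (j,i))"
  unfolding mtrace_def using assms
  by (auto simp: mult_mat_index[of _ n n _ n] simp del: index_mult_mat(1) intro!: sum.cong)

lemma mtrace_minus:
  "A \<in> carrier_mat n n \<Longrightarrow> B \<in> carrier_mat n n \<Longrightarrow> mtrace (A - B) = mtrace A - mtrace B"
  by (auto simp: mtrace_def sum_subtractf[symmetric] intro!: sum.cong)

lemma mtrace_comm:
  assumes "A \<in> carrier_mat n n" "B \<in> carrier_mat n n"
  shows "mtrace (A * B) = mtrace (B * A)"
  unfolding mtrace_mult[OF assms] mtrace_mult[OF assms(2,1)]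
  by (subst sum.swap) (simp add: mult.commute)

text \<open>Cyclicity turns this into the trace of
  \<open>real_diag n h * X * real_diag n k * adj X\<close> with \<open>X = adj U * V\<close>, where
  each entry of \<open>X\<close> is paired with its own conjugate.\<close>

lemma mtrace_udiag_mult_udiag:
  assumes U: "unitary_mat n U" and V: "unitary_mat n V"
  shows "mtrace (udiag n U h * udiag n V k) =
    of_real (\<Sum>i<n. \<Sum>j<n. (cmod ((adj U * V) $$ (i,j)))\<^sup>2 * (h i * k j))"
proof -
  note u = unitary_matD[OF U] and v = unitary_matD[OF V]
  define X where "X = adj U * V"
  have X: "X \<in> carrier_mat n n"
    unfolding X_def using u v by simp
  let ?D = "real_diag n h * X * real_diag n k"
  have "mtrace (udiag n U h * udiag n V k) = mtrace ((U * ?D) * adj V)"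
    by (simp add: udiag_mult_udiag[OF U V] X_def)
  also have "\<dots> = mtrace (adj V * (U * ?D))"
    using u v X by (intro mtrace_comm[of _ n]) auto
  also have "adj V * (U * ?D) = adj X * ?D"
    unfolding X_def using u v by (simp add: adj_mult_square[where n=n] assoc_mult_mat_square[where n=n])
  also have "mtrace \<dots> = mtrace (?D * adj X)"
    using X by (intro mtrace_comm[of _ n]) auto
  also have "\<dots> = (\<Sum>i<n. \<Sum>j<n. ?D $$ (i,j) * adj X $$ (j,i))"
    using X by (intro mtrace_mult) auto
  also have "\<dots> = (\<Sum>i<n. \<Sum>j<n. of_real ((cmod (X $$ (i,j)))\<^sup>2 * (h i * k j)))"
  proof (intro sum.cong refl)
    fix i j assume ij: "i \<in> {..<n}" "j \<in> {..<n}"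
    have "?D $$ (i,j) * adj X $$ (j,i) =
        (X $$ (i,j) * cnj (X $$ (i,j))) * of_real (h i * k j)"
      using ij X by (simp add: sandwich_index adj_index[of _ n n] del: index_mult_mat)
    also have "\<dots> = of_real ((cmod (X $$ (i,j)))\<^sup>2 * (h i * k j))"
      unfolding complex_norm_square[symmetric] by simp
    finally show "?D $$ (i,j) * adj X $$ (j,i) = of_real ((cmod (X $$ (i,j)))\<^sup>2 * (h i * k j))" .
  qed
  finally show ?thesis
    by (simp add: X_def del: index_mult_mat)
qed

text \<open>This is the diagonal of \<open>X * adj X\<close>. Together with
  \<open>unitary_col_sum\<close> it makes the squared moduli doubly stochastic.\<close>

lemma unitary_row_sum:
  assumes X: "unitary_mat n X" and "i < n"
  shows "(\<Sum>j<n. (cmod (X $$ (i,j)))\<^sup>2) = 1"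
proof -
  have "(X * adj X) $$ (i,i) = of_real (\<Sum>j<n. (cmod (X $$ (i,j)))\<^sup>2)"
    unfolding of_real_sum complex_norm_square using assms unitary_matD[OF X]
    by (subst mult_mat_index[of _ n n _ n]) (auto simp: adj_index[of _ n n])
  then have "complex_of_real (\<Sum>j<n. (cmod (X $$ (i,j)))\<^sup>2) = of_real 1"
    using unitary_matD[OF X] assms by simp
  then show ?thesis
    by (simp only: of_real_eq_iff)
qed

lemma unitary_col_sum:
  assumes X: "unitary_mat n X" and "j < n"
  shows "(\<Sum>i<n. (cmod (X $$ (i,j)))\<^sup>2) = 1"
  using unitary_row_sum[OF unitary_mat_adj[OF X] assms(2)] unitary_matD[OF X] assms(2)
  by (simp add: adj_index[of _ n n])

lemma unitary_entry_le:
  assumes X: "unitary_mat n X" and "i < n" "j < n"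
  shows "cmod (X $$ (i,j)) \<le> 1"
proof -
  have "(cmod (X $$ (i,j)))\<^sup>2 \<le> (\<Sum>j<n. (cmod (X $$ (i,j)))\<^sup>2)"
    using assms by (intro member_le_sum) auto
  then show ?thesis
    using unitary_row_sum[OF X assms(2)] by (simp add: power_le_one_iff abs_square_le_1)
qed

lemma mtrace_udiag:
  assumes U: "unitary_mat n U"
  shows "mtrace (udiag n U d) = of_real (\<Sum>i<n. d i)"
proof -
  have "mtrace (udiag n U d) = mtrace (adj U * (U * real_diag n d))"
    unfolding udiag_def using unitary_matD[OF U] by (intro mtrace_comm[of _ n]) auto
  also have "adj U * (U * real_diag n d) = (adj U * U) * real_diag n d"
    using unitary_matD(1,2)[OF U] by (simp add: assoc_mult_mat_square[where n=n])
  also have "\<dots> = real_diag n d"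
    using unitary_matD[OF U] by (simp add: left_mult_one_mat[of _ n n])
  finally show ?thesis
    by (simp add: mtrace_def real_diag_def)
qed

section \<open>Entry norm and eigenvalue bounds\<close>

definition entry_norm :: "nat \<Rightarrow> complex mat \<Rightarrow> real" where
  "entry_norm n A = (\<Sum>i<n. \<Sum>j<n. cmod (A $$ (i,j)))"

lemma entry_norm_nonneg: "entry_norm n A \<ge> 0"
  unfolding entry_norm_def by (intro sum_nonneg) auto

text \<open>Unitary entries have modulus at most 1, so the total of the moduli of the entries of
  \<open>Q\<close> dominates each entry with respect to any pair of orthonormal bases.\<close>

lemma unitary_conj_entry_le:
  assumes U: "unitary_mat n U" and V: "unitary_mat n V" and Q: "Q \<in> carrier_mat n n"
    and ij: "i < n" "j < n"
  shows "cmod ((adj U * Q * V) $$ (i,j)) \<le> entry_norm n Q"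
proof -
  note u = unitary_matD[OF U] and v = unitary_matD[OF V]
  have "(adj U * Q * V) $$ (i,j) = (\<Sum>l<n. (\<Sum>k<n. adj U $$ (i,k) * Q $$ (k,l)) * V $$ (l,j))"
    using u v Q ij
    by (subst mult_mat_index[of _ n n _ n])
       (auto simp: mult_mat_index[of _ n n _ n] simp del: index_mult_mat(1) intro!: sum.cong)
  also have "\<dots> = (\<Sum>l<n. \<Sum>k<n. adj U $$ (i,k) * Q $$ (k,l) * V $$ (l,j))"
    by (simp add: sum_distrib_right)
  also have "cmod \<dots> \<le> (\<Sum>l<n. \<Sum>k<n. cmod (Q $$ (k,l)))"
  proof (intro sum_norm_le)
    fix k l assume "l \<in> {..<n}" "k \<in> {..<n}"
    then have "cmod (adj U $$ (i,k)) \<le> 1" "cmod (V $$ (l,j)) \<le> 1"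
      using unitary_entry_le[OF unitary_mat_adj[OF U]] unitary_entry_le[OF V] ij by auto
    then have "cmod (adj U $$ (i,k)) * cmod (Q $$ (k,l)) * cmod (V $$ (l,j)) \<le> 1 * cmod (Q $$ (k,l)) * 1"
      by (intro mult_mono) auto
    then show "cmod (adj U $$ (i,k) * Q $$ (k,l) * V $$ (l,j)) \<le> cmod (Q $$ (k,l))"
      by (simp add: norm_mult)
  qed
  also have "\<dots> = entry_norm n Q"
    unfolding entry_norm_def by (rule sum.swap)
  finally show ?thesis .
qed

text \<open>An eigenvalue is a diagonal entry of the matrix in its eigenbasis.\<close>

lemma eigenvalue_le_entry_norm:
  assumes V: "unitary_mat n V" and "j < n"
  shows "\<bar>a j\<bar> \<le> entry_norm n (udiag n V a)"
proof -
  have "(adj V * udiag n V a * V) $$ (j,j) = of_real (a j)"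
    unfolding unitary_conj_udiag[OF V] using assms by (simp add: real_diag_def)
  then show ?thesis
    using unitary_conj_entry_le[OF V V _ assms(2) assms(2), of "udiag n V a"] unitary_matD[OF V] by simp
qed

text \<open>A generalized inverse \<open>Q\<close> keeps the nonzero eigenvalues away from zero.\<close>
lemma nonzero_eigenvalue_ge:
  assumes V: "unitary_mat n V" and Q: "Q \<in> carrier_mat n n"
    and M: "udiag n V a * Q * udiag n V a = udiag n V a"
    and j: "j < n" "a j \<noteq> 0"
  shows "1 \<le> \<bar>a j\<bar> * entry_norm n Q"
proof -
  note v = unitary_matD[OF V]
  let ?Y = "adj V * Q * V"
  \<comment> \<open>In the eigenbasis the assumption \<open>M\<close> relates
    \<open>real_diag n a\<close> to \<open>real_diag n a * ?Y * real_diag n a\<close>; the diagonal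
    entry at \<open>j\<close> can then be divided by \<open>a j\<close>.\<close>
  have "real_diag n a = adj V * (udiag n V a * Q * udiag n V a) * V"
    unfolding M unitary_conj_udiag[OF V] ..
  also have "\<dots> = (adj V * V) * real_diag n a * ?Y * real_diag n a * (adj V * V)"
    unfolding udiag_def using v(1,2) Q by (simp add: assoc_mult_mat_square[where n=n])
  also have "\<dots> = real_diag n a * ?Y * real_diag n a"
    using v(1,2) Q by (simp add: v(4) left_mult_one_mat[of _ n n] right_mult_one_mat[of _ n n])
  finally have "real_diag n a $$ (j,j) = (real_diag n a * ?Y * real_diag n a) $$ (j,j)"
    by (rule arg_cong)
  moreover have "(real_diag n a * ?Y * real_diag n a) $$ (j,j) = of_real (a j) * ?Y $$ (j,j) * of_real (a j)"
    using j v Q by (intro sandwich_index) auto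
  moreover have "real_diag n a $$ (j,j) = of_real (a j)"
    using j by (simp add: real_diag_def)
  ultimately have "of_real (a j) = of_real (a j) * ?Y $$ (j,j) * of_real (a j)"
    by simp
  then have "of_real (a j) * ?Y $$ (j,j) = 1"
    using j by simp
  then have "\<bar>a j\<bar> * cmod (?Y $$ (j,j)) = 1"
    by (metis norm_mult norm_of_real norm_one)
  then show ?thesis
    using unitary_conj_entry_le[OF V V Q j(1) j(1)] mult_left_mono[of "cmod (?Y $$ (j,j))" "entry_norm n Q" "\<bar>a j\<bar>"]
    by simp
qed

text \<open>All traces below are sums against the doubly stochastic weights \<open>(cmod ((adj U * V) $$ (i,j)))\<^sup>2\<close>,
  which reduces the matrix Taylor bound to the scalar one (as in the proof of Klein's inequality).\<close>
lemma trace_taylor_bound: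
  assumes U: "unitary_mat n U" and V: "unitary_mat n V" and C: "C \<ge> 0"
    and tay: "\<And>i j. i < n \<Longrightarrow> j < n \<Longrightarrow> \<bar>f (a j) - f (b i) - f' (b i) * (a j - b i)\<bar> \<le> C * (a j - b i)\<^sup>2"
  shows "\<bar>(\<Sum>j<n. f (a j)) - (\<Sum>i<n. f (b i))
      - Re (mtrace (udiag n U (\<lambda>i. f' (b i)) * (udiag n V a - udiag n U b)))\<bar>
    \<le> C * (real n)\<^sup>2 * (entry_norm n (udiag n V a - udiag n U b))\<^sup>2"
proof -
  note u = unitary_matD[OF U] and v = unitary_matD[OF V]
  let ?A = "udiag n V a" and ?B = "udiag n U b" and ?F = "udiag n U (\<lambda>i. f' (b i))"
  define X where "X = adj U * V"
  have uX: "unitary_mat n X"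
    unfolding X_def by (intro unitary_mat_mult unitary_mat_adj U V)
  define w where "w i j = (cmod (X $$ (i,j)))\<^sup>2" for i j
  have w1: "(\<Sum>j<n. w i j) = 1" if "i < n" for i
    unfolding w_def by (rule unitary_row_sum[OF uX that])
  have w2: "(\<Sum>i<n. w i j) = 1" if "j < n" for j
    unfolding w_def by (rule unitary_col_sum[OF uX that])
  \<comment> \<open>Row and column sums 1 allow every sum over one spectrum to be rewritten over the
    same weighted pairs.\<close>
  have row: "(\<Sum>i<n. \<Sum>j<n. w i j * k i) = (\<Sum>i<n. k i)" for k
    using w1 by (simp add: sum_distrib_right[symmetric])
  have col: "(\<Sum>i<n. \<Sum>j<n. w i j * k j) = (\<Sum>i<n. k i)" for k
    using w2 by (subst sum.swap) (simp add: sum_distrib_right[symmetric])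
  have "mtrace (?F * (?A - ?B)) = mtrace (?F * ?A) - mtrace (?F * ?B)"
    using u v by (simp add: mult_minus_distrib_mat[of _ n n _ n] mtrace_minus[of _ n])
  then have "Re (mtrace (?F * (?A - ?B))) =
      (\<Sum>i<n. \<Sum>j<n. w i j * (f' (b i) * a j)) - (\<Sum>i<n. f' (b i) * b i)"
    by (simp add: mtrace_udiag_mult_udiag[OF U V] udiag_mult[OF U] mtrace_udiag[OF U] w_def X_def
        del: index_mult_mat)
  then have eq: "(\<Sum>j<n. f (a j)) - (\<Sum>i<n. f (b i)) - Re (mtrace (?F * (?A - ?B))) =
      (\<Sum>i<n. \<Sum>j<n. w i j * (f (a j) - f (b i) - f' (b i) * (a j - b i)))"
    unfolding row[of "\<lambda>i. f' (b i) * b i", symmetric] col[of "\<lambda>j. f (a j)", symmetric]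
      row[of "\<lambda>i. f (b i)", symmetric]
    by (simp add: sum_subtractf algebra_simps)
  have "\<bar>w i j * (f (a j) - f (b i) - f' (b i) * (a j - b i))\<bar> \<le> C * (entry_norm n (?A - ?B))\<^sup>2"
    if ij: "i < n" "j < n" for i j
  proof -
    \<comment> \<open>Between the two eigenbases the difference has entries
      \<open>X $$ (i,j) * (a j - b i)\<close>, the overlap times the eigenvalue gap. This is what
      turns the scalar quadratic error into a norm.\<close>
    have "adj U * (?A - ?B) * V = adj U * V * (adj V * ?A * V) - (adj U * ?B * U) * (adj U * V)"
    proof -
      have "adj U * V * (adj V * ?A * V) = adj U * (V * adj V) * ?A * V"
        using u(1,2) v(1,2) by (simp add: assoc_mult_mat_square[where n=n])
      moreover have "(adj U * ?B * U) * (adj U * V) = adj U * ?B * (U * adj U) * V"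
        using u(1,2) v(1,2) by (simp add: assoc_mult_mat_square[where n=n])
      ultimately show ?thesis
        using u v by (simp add: mult_minus_distrib_mat[of _ n n _ n] minus_mult_distrib_mat[of _ n n _ _ n]
            right_mult_one_mat[of _ n n])
    qed
    also have "\<dots> = X * real_diag n a - real_diag n b * X"
      by (simp add: unitary_conj_udiag[OF U] unitary_conj_udiag[OF V] X_def)
    finally have "(adj U * (?A - ?B) * V) $$ (i,j) = X $$ (i,j) * of_real (a j - b i)"
      using ij unitary_matD(1)[OF uX] mult_real_diag_index[of X n i j a] real_diag_mult_index[of X n i j b]
        carrier_matD[OF real_diag_carrier_mat]
      by (simp add: algebra_simps)
    then have "cmod (X $$ (i,j)) * \<bar>a j - b i\<bar> \<le> entry_norm n (?A - ?B)"
      using unitary_conj_entry_le[OF U V _ ij, of "?A - ?B"] u v by (simp only: norm_mult norm_of_real minus_carrier_mat udiag_carrier_mat)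
    then have "(cmod (X $$ (i,j)) * \<bar>a j - b i\<bar>)\<^sup>2 \<le> (entry_norm n (?A - ?B))\<^sup>2"
      by (intro power_mono) auto
    then have 1: "w i j * (a j - b i)\<^sup>2 \<le> (entry_norm n (?A - ?B))\<^sup>2"
      by (simp add: w_def power_mult_distrib)
    have "\<bar>w i j * (f (a j) - f (b i) - f' (b i) * (a j - b i))\<bar> \<le> w i j * (C * (a j - b i)\<^sup>2)"
      using tay[OF ij] by (simp add: abs_mult w_def mult_left_mono)
    also have "\<dots> = C * (w i j * (a j - b i)\<^sup>2)" by simp
    also have "\<dots> \<le> C * (entry_norm n (?A - ?B))\<^sup>2"
      using 1 C by (rule mult_left_mono)
    finally show ?thesis .
  qed
  then have "\<bar>\<Sum>i<n. \<Sum>j<n. w i j * (f (a j) - f (b i) - f' (b i) * (a j - b i))\<bar>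
      \<le> (\<Sum>i<n. \<Sum>j<n. C * (entry_norm n (?A - ?B))\<^sup>2)"
    by (intro order_trans[OF sum_abs] sum_mono) auto
  also have "\<dots> = C * (real n)\<^sup>2 * (entry_norm n (?A - ?B))\<^sup>2"
    by (simp add: power2_eq_square)
  finally show ?thesis
    unfolding eq .
qed


section \<open>Differentiating the trace of a power\<close>

lemma supp_pow_0 [simp]: "supp_pow t 0 = 0"
  by (simp add: supp_pow_def)

lemma supp_pow_nonneg [simp]: "supp_pow t x \<ge> 0"
  by (simp add: supp_pow_def)

lemma supp_pow_mult: "supp_pow s x * supp_pow t x = supp_pow (s + t) x"
  by (simp add: supp_pow_def powr_add)

lemma supp_pow_supp_pow: "supp_pow s (supp_pow t x) = supp_pow (t * s) x"
  by (simp add: supp_pow_def powr_powr)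

lemma supp_pow_1: "x \<ge> 0 \<Longrightarrow> supp_pow 1 x = x"
  by (simp add: supp_pow_def)

lemma supp_ln_supp_pow: "supp_ln (supp_pow t x) = t * supp_ln x"
  by (simp add: supp_pow_def supp_ln_def ln_powr)

lemma supp_ln_0 [simp]: "supp_ln 0 = 0"
  by (simp add: supp_ln_def)

text \<open>The variable is in the exponent, so the jump at the edge of the support does no harm:
  for \<open>y \<le> 0\<close> the function and the claimed derivative both vanish.\<close>

lemma supp_pow_has_real_derivative:
  assumes "(s has_real_derivative s') (at x)"
  shows "((\<lambda>t. supp_pow (s t) y) has_real_derivative s' * (supp_pow (s x) y * supp_ln y)) (at x)"
proof (cases "y > 0")
  case True
  have "((\<lambda>t. exp (s t * ln y)) has_real_derivative exp (s x * ln y) * (s' * ln y)) (at x)"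
    by (auto intro!: derivative_eq_intros assms)
  then show ?thesis
    using True by (simp add: supp_pow_def supp_ln_def powr_def ac_simps)
qed (simp add: supp_pow_def)

lemma powr_le_exp_ln_bound:
  fixes x :: real
  assumes "x > 0" "\<bar>ln x\<bar> \<le> L" "\<bar>t\<bar> \<le> T"
  shows "x powr t \<le> exp (T * L)"
proof -
  have "t * ln x \<le> \<bar>t * ln x\<bar>"
    by (rule abs_ge_self)
  also have "\<dots> = \<bar>t\<bar> * \<bar>ln x\<bar>"
    by (rule abs_mult)
  also have "\<dots> \<le> T * L"
    using assms by (intro mult_mono) linarith+
  finally show ?thesis
    using assms by (simp add: powr_def)
qed

text \<open>At \<open>0\<close> the function \<open>supp_pow z\<close> is not smooth; the bound survives there because \<open>0\<close> is
  isolated in the set of admissible arguments.\<close>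
lemma supp_pow_taylor:
  assumes z: "\<bar>z\<bar> \<le> Z" and a: "a = 0 \<or> a > 0 \<and> \<bar>ln a\<bar> \<le> L" and b: "b = 0 \<or> b > 0 \<and> \<bar>ln b\<bar> \<le> L"
  shows "\<bar>supp_pow z a - supp_pow z b - (z * supp_pow (z - 1) b) * (a - b)\<bar>
    \<le> ((Z + 1)\<^sup>2 * exp ((Z + 2) * L)) * (a - b)\<^sup>2"
proof -
  let ?E = "exp ((Z + 2) * L)"
  have Z: "Z \<ge> 0" using z by simp
  \<comment> \<open>When the other argument is 0, \<open>x\<^sup>2\<close> is the squared distance,
    and the remaining factor \<open>x powr (z - 2)\<close> is bounded.\<close>
  have sq: "x powr z \<le> ?E * x\<^sup>2" if "x > 0" "\<bar>ln x\<bar> \<le> L" for x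
  proof -
    have "x powr z = x powr (z - 2) * x powr 2"
      using powr_add[of x "z - 2" 2] by simp
    also have "\<dots> \<le> ?E * x powr 2"
      using that z by (intro mult_right_mono powr_le_exp_ln_bound) auto
    finally show ?thesis
      using that by simp
  qed
  have Z1: "1 \<le> (Z + 1)\<^sup>2" "Z + 1 \<le> (Z + 1)\<^sup>2" "Z * (Z + 1) \<le> (Z + 1)\<^sup>2"
    using Z by (auto simp: power2_eq_square algebra_simps)
  \<comment> \<open>Equal positive arguments form a case of their own because \<open>Taylor\<close>
    requires distinct points.\<close>
  consider "a = 0" "b = 0" | "a > 0" "\<bar>ln a\<bar> \<le> L" "b = 0" | "a = 0" "b > 0" "\<bar>ln b\<bar> \<le> L"
    | "a = b" "b > 0" | "a > 0" "\<bar>ln a\<bar> \<le> L" "b > 0" "\<bar>ln b\<bar> \<le> L" "a \<noteq> b"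
    using a b by blast
  then show ?thesis
  proof cases
    case 2
    then have "a powr z \<le> 1 * ?E * a\<^sup>2" using sq by simp
    also have "\<dots> \<le> (Z + 1)\<^sup>2 * ?E * a\<^sup>2"
      using Z1 by (intro mult_right_mono) auto
    finally show ?thesis
      using 2 by (simp add: supp_pow_def)
  next
    case 3
    have "b powr (z - 1) * b = b powr z"
      using 3 by (simp add: powr_diff)
    \<comment> \<open>For \<open>a = 0\<close> the linear term contributes
      \<open>z * b powr z\<close>, which leaves the factor \<open>z - 1\<close>.\<close>
    then have "supp_pow z a - supp_pow z b - (z * supp_pow (z - 1) b) * (a - b) = (z - 1) * b powr z"
      using 3 by (simp add: supp_pow_def algebra_simps)
    also have "\<bar>\<dots>\<bar> \<le> (Z + 1) * (?E * b\<^sup>2)"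
      unfolding abs_mult using 3 z sq by (intro mult_mono) auto
    also have "\<dots> \<le> (Z + 1)\<^sup>2 * (?E * b\<^sup>2)"
      using Z1 by (intro mult_right_mono) auto
    finally show ?thesis
      using 3 by simp
  next
    case 5
    define diff :: "nat \<Rightarrow> real \<Rightarrow> real" where
      "diff m x = (case m of 0 \<Rightarrow> x powr z | Suc 0 \<Rightarrow> z * x powr (z - 1)
        | Suc (Suc _) \<Rightarrow> z * (z - 1) * x powr (z - 2))" for m x
    have d: "DERIV (diff m) x :> diff (Suc m) x" if "m < 2" "min a b \<le> x" for m x
    proof -
      have "x > 0" using that 5 by auto
      moreover have "m = 0 \<or> m = 1" using that by auto
      moreover have "((\<lambda>x. x powr z) has_real_derivative z * x powr (z - 1)) (at x)" if "x > 0"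
        using that by (rule has_real_derivative_powr)
      moreover have "((\<lambda>x. z * x powr (z - 1)) has_real_derivative z * ((z - 1) * x powr (z - 1 - 1))) (at x)" if "x > 0"
        by (intro DERIV_cmult has_real_derivative_powr that)
      ultimately show ?thesis
        unfolding diff_def by (auto simp: algebra_simps)
    qed
    obtain t where t: "if a < b then a < t \<and> t < b else b < t \<and> t < a"
      and eq: "a powr z = (\<Sum>m<2. diff m b / fact m * (a - b) ^ m) + diff 2 t / fact 2 * (a - b) ^ 2"
    proof -
      have "\<exists>t. (if a < b then a < t \<and> t < b else b < t \<and> t < a) \<and>
          a powr z = (\<Sum>m<2. diff m b / fact m * (a - b) ^ m) + diff 2 t / fact 2 * (a - b) ^ 2"
      proof (rule Taylor)
        show "diff 0 = (\<lambda>x. x powr z)"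
          by (simp add: diff_def fun_eq_iff)
        show "\<forall>m t. m < 2 \<and> min a b \<le> t \<and> t \<le> max a b \<longrightarrow> DERIV (diff m) t :> diff (Suc m) t"
          using d by blast
      qed (use 5 in auto)
      then show ?thesis
        using that by blast
    qed
    have t0: "t > 0" using t 5 by (auto split: if_splits)
    have "\<bar>ln t\<bar> \<le> L"
    proof -
      have "ln (min a b) \<le> ln t" "ln t \<le> ln (max a b)"
        using t 5 t0 by (auto split: if_splits)
      then show ?thesis
        using 5 by (auto simp: min_def max_def split: if_splits)
    qed
    then have "t powr (z - 2) \<le> ?E"
      using t0 z by (intro powr_le_exp_ln_bound) auto
    moreover have "\<bar>z * (z - 1)\<bar> \<le> Z * (Z + 1)"
      unfolding abs_mult using z by (intro mult_mono) auto
    ultimately have "\<bar>z * (z - 1)\<bar> * t powr (z - 2) \<le> Z * (Z + 1) * ?E"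
      using Z by (intro mult_mono) auto
    also have "\<dots> \<le> (Z + 1)\<^sup>2 * ?E"
      using Z1 by (intro mult_right_mono) auto
    finally have *: "\<bar>diff 2 t\<bar> \<le> (Z + 1)\<^sup>2 * ?E"
      by (simp add: diff_def abs_mult numeral_2_eq_2)
    have "supp_pow z a - supp_pow z b - (z * supp_pow (z - 1) b) * (a - b) = diff 2 t / 2 * (a - b)\<^sup>2"
      using eq 5 by (simp add: numeral_2_eq_2 diff_def supp_pow_def)
    also have "\<bar>\<dots>\<bar> = (\<bar>diff 2 t\<bar> / 2) * (a - b)\<^sup>2"
      by (simp add: abs_mult)
    also have "\<dots> \<le> ((Z + 1)\<^sup>2 * ?E) * (a - b)\<^sup>2"
      using * by (intro mult_right_mono) auto
    finally show ?thesis .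
  qed auto
qed

section \<open>Entrywise differentiation of matrix-valued functions\<close>

lemma has_vector_derivative_difference_quotient:
  assumes "(f has_vector_derivative f') (at x)"
  shows "((\<lambda>t. (f t - f x) /\<^sub>R (t - x)) \<longlongrightarrow> f') (at x)"
proof -
  have "((\<lambda>t. norm ((f t - f x) - (t - x) *\<^sub>R f') / norm (t - x)) \<longlongrightarrow> 0) (at x)"
    using assms by (simp add: has_vector_derivative_def has_derivative_iff_norm)
  moreover have "norm ((f t - f x) - (t - x) *\<^sub>R f') / norm (t - x) = norm ((f t - f x) /\<^sub>R (t - x) - f')"
    if "t \<noteq> x" for t
  proof -
    have "(f t - f x) /\<^sub>R (t - x) - f' = ((f t - f x) - (t - x) *\<^sub>R f') /\<^sub>R (t - x)"
      using that by (simp add: scaleR_diff_right)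
    then show ?thesis
      by (simp only: norm_scaleR norm_inverse divide_inverse real_norm_def abs_inverse mult.commute)
  qed
  then have "\<forall>\<^sub>F t in at x. norm ((f t - f x) - (t - x) *\<^sub>R f') / norm (t - x) = norm ((f t - f x) /\<^sub>R (t - x) - f')"
    by (simp add: eventually_at_filter)
  ultimately have "((\<lambda>t. norm ((f t - f x) /\<^sub>R (t - x) - f')) \<longlongrightarrow> 0) (at x)"
    by (rule Lim_transform_eventually)
  then show ?thesis
    by (rule LIM_zero_cancel[OF tendsto_norm_zero_cancel])
qed

text \<open>The carrier conditions are imposed at every \<open>t\<close>, so that products and
  differences raise no dimension conditions that hold only near \<open>x\<close>.\<close>

definition has_mat_derivative :: "nat \<Rightarrow> (real \<Rightarrow> complex mat) \<Rightarrow> complex mat \<Rightarrow> real \<Rightarrow> bool" where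
  "has_mat_derivative n F F' x \<longleftrightarrow> F' \<in> carrier_mat n n \<and> (\<forall>t. F t \<in> carrier_mat n n) \<and>
     (\<forall>i<n. \<forall>j<n. ((\<lambda>t. F t $$ (i,j)) has_vector_derivative F' $$ (i,j)) (at x))"

lemma has_mat_derivativeD:
  assumes "has_mat_derivative n F F' x"
  shows "F t \<in> carrier_mat n n" "F' \<in> carrier_mat n n"
    "i < n \<Longrightarrow> j < n \<Longrightarrow> ((\<lambda>t. F t $$ (i,j)) has_vector_derivative F' $$ (i,j)) (at x)"
  using assms unfolding has_mat_derivative_def by auto

lemma has_mat_derivative_mult:
  assumes F: "has_mat_derivative n F F' x" and G: "has_mat_derivative n G G' x"
  shows "has_mat_derivative n (\<lambda>t. F t * G t) (F' * G x + F x * G') x"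
proof -
  note f = has_mat_derivativeD[OF F] and g = has_mat_derivativeD[OF G]
  have "((\<lambda>t. (F t * G t) $$ (i,j)) has_vector_derivative (F' * G x + F x * G') $$ (i,j)) (at x)"
    if ij: "i < n" "j < n" for i j
  proof -
    have "((\<lambda>t. \<Sum>k<n. F t $$ (i,k) * G t $$ (k,j)) has_vector_derivative
        (\<Sum>k<n. F x $$ (i,k) * G' $$ (k,j) + F' $$ (i,k) * G x $$ (k,j))) (at x)"
      by (intro has_vector_derivative_sum has_vector_derivative_mult f g) (use ij in auto)
    then show ?thesis
      using ij f(1,2) g(1,2) carrier_matD[OF f(1)] carrier_matD[OF f(2)] carrier_matD[OF g(1)] carrier_matD[OF g(2)]
      by (simp add: mult_mat_index[of _ n n _ n] sum.distrib add.commute)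
  qed
  then show ?thesis
    using f(1,2) g(1,2) unfolding has_mat_derivative_def by auto
qed

lemma has_mat_derivative_minus_const:
  assumes F: "has_mat_derivative n F F' x" and "C \<in> carrier_mat n n"
  shows "has_mat_derivative n (\<lambda>t. F t - C) F' x"
proof -
  note f = has_mat_derivativeD[OF F]
  have "((\<lambda>t. (F t - C) $$ (i,j)) has_vector_derivative F' $$ (i,j)) (at x)"
    if ij: "i < n" "j < n" for i j
  proof -
    have "((\<lambda>t. F t $$ (i,j) - C $$ (i,j)) has_vector_derivative F' $$ (i,j) - 0) (at x)"
      by (intro has_vector_derivative_diff f ij has_vector_derivative_const)
    moreover have "(F t - C) $$ (i,j) = F t $$ (i,j) - C $$ (i,j)" for t
      using f(1)[of t] assms(2) ij by simp
    ultimately show ?thesis by simp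
  qed
  then show ?thesis
    using f(1,2) assms(2) unfolding has_mat_derivative_def by (auto intro: minus_carrier_mat)
qed

lemma has_mat_derivative_udiag:
  assumes U: "U \<in> carrier_mat n n"
    and d: "\<And>k. k < n \<Longrightarrow> ((\<lambda>t. d t k) has_real_derivative d' k) (at x)"
  shows "has_mat_derivative n (\<lambda>t. udiag n U (d t)) (udiag n U d') x"
proof -
  have "((\<lambda>t. udiag n U (d t) $$ (i,j)) has_vector_derivative udiag n U d' $$ (i,j)) (at x)"
    if ij: "i < n" "j < n" for i j
  proof -
    have "((\<lambda>t. of_real (d t k)) has_vector_derivative (of_real (d' k) :: complex)) (at x)" if "k < n" for k
      using d[OF that] by (intro has_vector_derivative_of_real) (simp add: has_real_derivative_iff_has_vector_derivative)
    then have "((\<lambda>t. \<Sum>k<n. U $$ (i,k) * of_real (d t k) * cnj (U $$ (j,k))) has_vector_derivative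
       (\<Sum>k<n. U $$ (i,k) * of_real (d' k) * cnj (U $$ (j,k)))) (at x)"
      by (intro has_vector_derivative_sum has_vector_derivative_mult_left has_vector_derivative_mult_right) auto
    then show ?thesis
      using ij U by (simp add: udiag_index)
  qed
  then show ?thesis
    using U unfolding has_mat_derivative_def by auto
qed

lemma has_mat_derivative_mtrace:
  assumes F: "has_mat_derivative n F F' x"
  shows "((\<lambda>t. Re (mtrace (F t))) has_real_derivative Re (mtrace F')) (at x)"
proof -
  note f = has_mat_derivativeD[OF F]
  have "((\<lambda>t. \<Sum>i<n. F t $$ (i,i)) has_vector_derivative (\<Sum>i<n. F' $$ (i,i))) (at x)"
    by (intro has_vector_derivative_sum f) auto
  then have "((\<lambda>t. Re (\<Sum>i<n. F t $$ (i,i))) has_vector_derivative Re (\<Sum>i<n. F' $$ (i,i))) (at x)"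
    using bounded_linear.has_vector_derivative[OF bounded_linear_Re] by blast
  moreover have "dim_row (F t) = n" "dim_row F' = n" for t
    using f(1)[of t] f(2) by auto
  ultimately show ?thesis
    by (simp add: mtrace_def has_real_derivative_iff_has_vector_derivative del: Re_sum)
qed

lemma has_mat_derivative_entry_norm_tendsto:
  assumes F: "has_mat_derivative n F F' x"
  shows "((\<lambda>t. entry_norm n (F t)) \<longlongrightarrow> entry_norm n (F x)) (at x)"
proof -
  have "isCont (\<lambda>t. F t $$ (i,j)) x" if "i < n" "j < n" for i j
    using has_mat_derivativeD(3)[OF F that] unfolding has_vector_derivative_def by (rule has_derivative_continuous)
  then show ?thesis
    unfolding entry_norm_def isCont_def by (intro tendsto_sum tendsto_norm) auto
qed

text \<open>The difference is of order \<open>t - x\<close>, so its square remains negligible after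
  division by \<open>t - x\<close>. This disposes of the Taylor remainder.\<close>

lemma has_mat_derivative_difference_tendsto:
  assumes F: "has_mat_derivative n F F' x"
  shows "((\<lambda>t. (entry_norm n (F t - F x))\<^sup>2 / (t - x)) \<longlongrightarrow> 0) (at x)"
proof -
  note f = has_mat_derivativeD[OF F]
  have "((\<lambda>t. entry_norm n (F t - F x) / \<bar>t - x\<bar>) \<longlongrightarrow> (\<Sum>i<n. \<Sum>j<n. cmod (F' $$ (i,j)))) (at x)"
  proof -
    have "((\<lambda>t. cmod ((F t - F x) $$ (i,j)) / \<bar>t - x\<bar>) \<longlongrightarrow> cmod (F' $$ (i,j))) (at x)" if ij: "i < n" "j < n" for i j
    proof -
      have "((\<lambda>t. (F t $$ (i,j) - F x $$ (i,j)) /\<^sub>R (t - x)) \<longlongrightarrow> F' $$ (i,j)) (at x)"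
        using f(3)[OF ij] by (rule has_vector_derivative_difference_quotient)
      moreover have "(F t - F x) $$ (i,j) = F t $$ (i,j) - F x $$ (i,j)" for t
        using ij carrier_matD[OF f(1)] by simp
      ultimately show ?thesis
        using tendsto_norm[of "\<lambda>t. (F t $$ (i,j) - F x $$ (i,j)) /\<^sub>R (t - x)"]
        by (simp add: divide_inverse mult.commute)
    qed
    then show ?thesis
      unfolding entry_norm_def sum_divide_distrib by (intro tendsto_sum) auto
  qed
  \<comment> \<open>The squared quotient has a finite limit and is multiplied by
    \<open>t - x\<close>.\<close>
  then have "((\<lambda>t. (entry_norm n (F t - F x) / \<bar>t - x\<bar>)\<^sup>2 * (t - x)) \<longlongrightarrow>
      (\<Sum>i<n. \<Sum>j<n. cmod (F' $$ (i,j)))\<^sup>2 * (x - x)) (at x)"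
    by (intro tendsto_intros)
  moreover have "(entry_norm n (F t - F x) / \<bar>t - x\<bar>)\<^sup>2 * (t - x) = (entry_norm n (F t - F x))\<^sup>2 / (t - x)" for t
    by (simp add: power_divide power2_eq_square)
  ultimately show ?thesis by simp
qed

text \<open>The trace is compared with \<open>H\<close>, its first-order expansion around the fixed
  spectrum of \<open>M x\<close> but with the moving exponent \<open>g t\<close>. \<open>H\<close>
  agrees with the trace at \<open>x\<close> and is differentiable by the product rule, while
  \<open>trace_taylor_bound\<close> makes the error quadratic. The spectral gap \<open>c\<close>
  keeps the constant uniform in \<open>t\<close>.\<close>

lemma mtrace_mpow_has_derivative:
  assumes M: "has_mat_derivative n M M' x"
    and W: "unitary_mat n W" and Mx: "M x = udiag n W b" and b: "\<And>i. i < n \<Longrightarrow> b i \<ge> 0"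
    and c: "c > 0"
    and ev: "\<forall>\<^sub>F t in at x. \<exists>V a. unitary_mat n V \<and> M t = udiag n V a \<and> (\<forall>j<n. a j = 0 \<or> c \<le> a j)"
    and g: "(g has_real_derivative g') (at x)"
  shows "((\<lambda>t. Re (mtrace (mpow n (M t) (g t)))) has_real_derivative
      g' * (\<Sum>i<n. supp_pow (g x) (b i) * supp_ln (b i))
      + Re (mtrace (udiag n W (\<lambda>i. g x * supp_pow (g x - 1) (b i)) * M'))) (at x)"
    (is "(?T has_real_derivative ?D) (at x)")
proof -
  note m = has_mat_derivativeD[OF M] and w = unitary_matD[OF W]
  define G where "G t = udiag n W (\<lambda>i. g t * supp_pow (g t - 1) (b i))" for t
  define H where "H t = (\<Sum>i<n. supp_pow (g t) (b i)) + Re (mtrace (G t * (M t - M x)))" for t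
  have g1: "((\<lambda>t. g t - 1) has_real_derivative g') (at x)"
    by (auto intro!: derivative_eq_intros g)
  have "((\<lambda>t. g t * supp_pow (g t - 1) (b k)) has_real_derivative
      g' * supp_pow (g x - 1) (b k) + (g' * (supp_pow (g x - 1) (b k) * supp_ln (b k))) * g x) (at x)" for k
    by (intro DERIV_mult g supp_pow_has_real_derivative g1)
  then obtain G' where G': "has_mat_derivative n G G' x"
    unfolding G_def using has_mat_derivative_udiag[OF w(1)] by meson
  note gd = has_mat_derivativeD[OF G']
  have "((\<lambda>t. Re (mtrace (G t * (M t - M x)))) has_real_derivative
      Re (mtrace (G' * (M x - M x) + G x * M'))) (at x)"
    by (intro has_mat_derivative_mtrace[where n=n] has_mat_derivative_mult G' has_mat_derivative_minus_const M m)
  \<comment> \<open>The derivative of \<open>G\<close> is multiplied by the zero matrix and drops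
    out.\<close>
  also have "G' * (M x - M x) + G x * M' = G x * M'"
    using m gd by (simp add: right_mult_zero_mat[of _ n n] minus_r_inv_mat[of _ n n])
  finally have "((\<lambda>t. Re (mtrace (G t * (M t - M x)))) has_real_derivative Re (mtrace (G x * M'))) (at x)" .
  then have "(H has_real_derivative
      (\<Sum>i<n. g' * (supp_pow (g x) (b i) * supp_ln (b i))) + Re (mtrace (G x * M'))) (at x)"
    unfolding H_def by (intro DERIV_add DERIV_sum supp_pow_has_real_derivative g)
  then have H: "(H has_real_derivative ?D) (at x)"
    by (simp add: G_def sum_distrib_left)
  have mpow: "?T t = (\<Sum>j<n. supp_pow (g t) (a j))" if "unitary_mat n V" "M t = udiag n V a" for t V a
    using that by (simp add: mpow_def mat_fun_udiag mtrace_udiag)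
  have "M x - M x = 0\<^sub>m n n"
    using m by (simp add: minus_r_inv_mat[of _ n n])
  then have Hx: "H x = ?T x"
    unfolding mpow[OF W Mx] using gd(1)[of x]
    by (simp add: H_def right_mult_zero_mat[of _ n n] mtrace_def)
  \<comment> \<open>The summand 1 leaves room for the bound to hold for all \<open>t\<close> near
    \<open>x\<close>; the same device gives \<open>Z\<close>.\<close>
  define K where "K = entry_norm n (M x) + 1"
  have evK: "\<forall>\<^sub>F t in at x. entry_norm n (M t) < K"
    using has_mat_derivative_entry_norm_tendsto[OF M] by (rule order_tendstoD) (simp add: K_def)
  define Z where "Z = \<bar>g x\<bar> + 1"
  have "((\<lambda>t. \<bar>g t\<bar>) \<longlongrightarrow> \<bar>g x\<bar>) (at x)"
    using DERIV_isCont[OF g] by (intro tendsto_rabs) (simp add: isCont_def)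
  then have evZ: "\<forall>\<^sub>F t in at x. \<bar>g t\<bar> < Z"
    by (rule order_tendstoD) (simp add: Z_def)
  \<comment> \<open>Bounds the logarithm on both spectra: \<open>c\<close> and \<open>K\<close>
    confine the nonzero eigenvalues of \<open>M t\<close>, and the sum covers those of
    \<open>M x\<close>.\<close>
  define L where "L = \<bar>ln c\<bar> + \<bar>ln K\<bar> + (\<Sum>i<n. \<bar>ln (b i)\<bar>)"
  define C where "C = (Z + 1)\<^sup>2 * exp ((Z + 2) * L)"
  have "C \<ge> 0" by (simp add: C_def)
  have bound: "\<forall>\<^sub>F t in at x. \<bar>?T t - H t\<bar> \<le> C * (real n)\<^sup>2 * (entry_norm n (M t - M x))\<^sup>2"
    using ev evK evZ
  proof eventually_elim
    case (elim t)
    then obtain V a where V: "unitary_mat n V" and Mt: "M t = udiag n V a"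
      and a: "\<And>j. j < n \<Longrightarrow> a j = 0 \<or> c \<le> a j" by blast
    have aL: "a j = 0 \<or> a j > 0 \<and> \<bar>ln (a j)\<bar> \<le> L" if "j < n" for j
    proof (cases "a j = 0")
      case False
      then have "c \<le> a j" using a that by blast
      moreover have "a j \<le> K"
        using eigenvalue_le_entry_norm[OF V that, of a] elim Mt by simp
      ultimately have "ln c \<le> ln (a j)" "ln (a j) \<le> ln K" "a j > 0"
        using c by auto
      moreover have "(\<Sum>i<n. \<bar>ln (b i)\<bar>) \<ge> 0" by (intro sum_nonneg) auto
      ultimately show ?thesis
        unfolding L_def by linarith
    qed auto
    have bL: "b i = 0 \<or> b i > 0 \<and> \<bar>ln (b i)\<bar> \<le> L" if "i < n" for i
    proof -
      have "\<bar>ln (b i)\<bar> \<le> (\<Sum>i<n. \<bar>ln (b i)\<bar>)"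
        using that by (intro member_le_sum) auto
      then show ?thesis
        using b[OF that] unfolding L_def by auto
    qed
    have "\<bar>(\<Sum>j<n. supp_pow (g t) (a j)) - (\<Sum>i<n. supp_pow (g t) (b i))
      - Re (mtrace (udiag n W (\<lambda>i. g t * supp_pow (g t - 1) (b i)) * (udiag n V a - udiag n W b)))\<bar>
      \<le> C * (real n)\<^sup>2 * (entry_norm n (udiag n V a - udiag n W b))\<^sup>2"
      by (intro trace_taylor_bound[where f' = "\<lambda>y. g t * supp_pow (g t - 1) y"] W V \<open>C \<ge> 0\<close>)
         (use aL bL elim in \<open>auto simp: C_def intro!: supp_pow_taylor\<close>)
    then show ?case
      unfolding mpow[OF V Mt] H_def G_def unfolding Mt Mx by (simp add: algebra_simps)
  qed
  have "((\<lambda>t. (?T t - H t) / (t - x)) \<longlongrightarrow> 0) (at x)"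
  proof (rule tendsto_0_le)
    show "((\<lambda>t. (entry_norm n (M t - M x))\<^sup>2 / (t - x)) \<longlongrightarrow> 0) (at x)"
      by (rule has_mat_derivative_difference_tendsto[OF M])
    show "\<forall>\<^sub>F t in at x. norm ((?T t - H t) / (t - x)) \<le>
        norm ((entry_norm n (M t - M x))\<^sup>2 / (t - x)) * (C * (real n)\<^sup>2)"
      using bound by eventually_elim (simp add: divide_right_mono mult.commute)
  qed
  \<comment> \<open>The difference quotient of \<open>H\<close> and the vanishing error add up to
    the difference quotient of the trace, because both functions agree at \<open>x\<close>.\<close>
  then have "((\<lambda>t. (H t - H x) / (t - x) + (?T t - H t) / (t - x)) \<longlongrightarrow> ?D + 0) (at x)"
    using H by (intro tendsto_add) (simp add: has_field_derivative_iff)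
  moreover have "(H t - H x) / (t - x) + (?T t - H t) / (t - x) = (?T t - ?T x) / (t - x)" for t
    unfolding Hx by (simp add: add_divide_distrib[symmetric])
  ultimately show ?thesis
    by (simp add: has_field_derivative_iff)
qed


section \<open>The limit of the Renyi entropies\<close>

lemma udiag_mult_unitary:
  assumes "unitary_mat n U"
  shows "udiag n U d * U = U * real_diag n d" "adj U * udiag n U d = real_diag n d * adj U"
proof -
  note u = unitary_matD[OF assms]
  show "udiag n U d * U = U * real_diag n d"
    unfolding udiag_def using u(1,2) by (simp add: assoc_mult_mat_square[where n=n] u(4) right_mult_one_mat[of _ n n])
  have "adj U * udiag n U d = (adj U * U) * real_diag n d * adj U"
    unfolding udiag_def using u(1,2) by (simp add: assoc_mult_mat_square[where n=n])
  then show "adj U * udiag n U d = real_diag n d * adj U"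
    using u(1,2) by (simp add: u(4) left_mult_one_mat[of _ n n])
qed

lemma mult_mat_vec_col_index:
  assumes "A \<in> carrier_mat n n" "U \<in> carrier_mat n n" "i < n" "j < n"
  shows "(A *\<^sub>v col U j) $ i = (A * U) $$ (i,j)"
  using assms by (simp add: index_mult_mat(1))

text \<open>The quadratic form evaluated at the columns of \<open>U\<close> returns the
  eigenvalues.\<close>

lemma psd_mat_udiag:
  assumes "psd_mat n A"
  shows "\<exists>U d. unitary_mat n U \<and> A = udiag n U d \<and> (\<forall>i<n. 0 \<le> d i)"
proof -
  obtain U d where U: "unitary_mat n U" and A: "A = udiag n U d"
    using assms hermitian_mat_udiag unfolding psd_mat_def by blast
  note u = unitary_matD[OF U]
  have "0 \<le> d j" if j: "j < n" for j
  proof -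
    have "(\<Sum>i<n. cnj (col U j $ i) * (A *\<^sub>v col U j) $ i) = (\<Sum>i<n. adj U $$ (j,i) * (A * U) $$ (i,j))"
      using u j A by (intro sum.cong refl) (simp add: mult_mat_vec_col_index[of _ n] adj_index[of _ n n])
    also have "\<dots> = (adj U * (A * U)) $$ (j,j)"
      using u j A by (subst mult_mat_index[of _ n n _ n]) auto
    also have "adj U * (A * U) = adj U * udiag n U d * U"
      using u A by (simp add: assoc_mult_mat_square[where n=n])
    also have "\<dots> $$ (j,j) = of_real (d j)"
      unfolding unitary_conj_udiag[OF U] using j by (simp add: real_diag_def)
    finally have "Re (\<Sum>i<n. cnj (col U j $ i) * (A *\<^sub>v col U j) $ i) = d j"
      by simp
    moreover have "col U j \<in> carrier_vec n"
      using u(1) by (auto intro: carrier_vecI)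
    ultimately show ?thesis
      using assms unfolding psd_mat_def by metis
  qed
  then show ?thesis
    using U A by blast
qed

text \<open>With \<open>Y = adj V * X * W\<close>, the eigenvalue is the sum of the
  \<open>r k\<close> weighted by the squared moduli of row \<open>j\<close> of
  \<open>Y\<close>.\<close>

lemma congruence_eigenvalue_nonneg:
  assumes V: "unitary_mat n V" and X: "X \<in> carrier_mat n n" and W: "W \<in> carrier_mat n n"
    and eq: "udiag n V a = X * udiag n W r * adj X" and r: "\<And>k. k < n \<Longrightarrow> r k \<ge> 0" and j: "j < n"
  shows "a j \<ge> 0"
proof -
  note v = unitary_matD[OF V]
  have "real_diag n a = adj V * (X * udiag n W r * adj X) * V"
    using unitary_conj_udiag[OF V, of a] eq by simp
  also have "\<dots> = (adj V * X) * udiag n W r * adj (adj V * X)"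
    using v(1,2) X W by (simp add: assoc_mult_mat_square[where n=n] adj_mult_square[where n=n])
  also have "\<dots> = udiag n (adj V * X * W) r"
    using v X W by (intro udiag_conj) auto
  finally have eq': "real_diag n a = udiag n (adj V * X * W) r" .
  define Y where "Y = adj V * X * W"
  have Y: "Y \<in> carrier_mat n n"
    unfolding Y_def using v X W by auto
  have "of_real (a j) = udiag n Y r $$ (j,j)"
    unfolding Y_def eq'[symmetric] using j by (simp add: real_diag_def)
  also have "\<dots> = (\<Sum>k<n. Y $$ (j,k) * of_real (r k) * cnj (Y $$ (j,k)))"
    using Y j by (intro udiag_index)
  also have "\<dots> = of_real (\<Sum>k<n. (cmod (Y $$ (j,k)))\<^sup>2 * r k)"
    unfolding of_real_sum of_real_mult complex_norm_square by (simp add: ac_simps)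
  finally have "a j = (\<Sum>k<n. (cmod (Y $$ (j,k)))\<^sup>2 * r k)"
    by (simp only: of_real_eq_iff)
  also have "\<dots> \<ge> 0"
    by (intro sum_nonneg mult_nonneg_nonneg) (auto intro: r)
  finally show ?thesis .
qed

text \<open>Column \<open>j\<close> of \<open>U\<close> lies in both kernels, and the kernel of
  \<open>udiag n W p\<close> is orthogonal to its eigenvectors for nonzero eigenvalues.\<close>

lemma kernel_subset_overlap_zero:
  assumes W: "unitary_mat n W" and U: "unitary_mat n U"
    and ker: "mat_kernel (udiag n U d) \<subseteq> mat_kernel (udiag n W p)"
    and ij: "i < n" "j < n" and d: "d j = 0" and p: "p i \<noteq> 0"
  shows "(adj W * U) $$ (i,j) = 0"
proof -
  note u = unitary_matD[OF U] and w = unitary_matD[OF W]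
  have "udiag n U d *\<^sub>v col U j = 0\<^sub>v n"
  proof (rule eq_vecI)
    fix k assume "k < dim_vec (0\<^sub>v n :: complex vec)"
    then show "(udiag n U d *\<^sub>v col U j) $ k = 0\<^sub>v n $ k"
      using ij u d by (simp add: mult_mat_vec_col_index[of _ n] udiag_mult_unitary[OF U] mult_real_diag_index)
  qed (use carrier_matD[OF udiag_carrier_mat[OF u(1)]] in simp)
  then have "col U j \<in> mat_kernel (udiag n U d)"
    using u carrier_matD[OF udiag_carrier_mat[OF u(1)]] unfolding mat_kernel_def by (auto intro: carrier_vecI)
  then have "udiag n W p *\<^sub>v col U j = 0\<^sub>v n"
    using ker carrier_matD[OF udiag_carrier_mat[OF w(1)]] unfolding mat_kernel_def by auto
  then have 0: "(udiag n W p * U) $$ (k,j) = 0" if "k < n" for k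
    using that ij u w mult_mat_vec_col_index[of "udiag n W p" n U k j] by simp
  have "of_real (p i) * (adj W * U) $$ (i,j) = (real_diag n p * (adj W * U)) $$ (i,j)"
    using ij u w by (simp add: real_diag_mult_index)
  also have "real_diag n p * (adj W * U) = adj W * (udiag n W p * U)"
  proof -
    have "real_diag n p * (adj W * U) = (real_diag n p * adj W) * U"
      using u w by (simp add: assoc_mult_mat_square[where n=n])
    also have "\<dots> = (adj W * udiag n W p) * U"
      by (simp add: udiag_mult_unitary[OF W])
    finally show ?thesis
      using u w by (simp add: assoc_mult_mat_square[where n=n])
  qed
  also have "\<dots> $$ (i,j) = 0"
    using ij u w 0 by (subst mult_mat_index[of _ n n _ n]) auto
  finally show ?thesis
    using p by simp
qed

text \<open>\<open>supp_pow 0\<close> is the indicator of the positive reals, so \<open>?P\<close>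
  is the support projection of \<open>udiag n U d\<close>. Eigenvectors with \<open>h i\<close>
  nonzero overlap only those with \<open>d j > 0\<close>. The second equation is the adjoint of the
  first.\<close>

lemma support_projection_absorb:
  assumes W: "unitary_mat n W" and U: "unitary_mat n U"
    and ker: "mat_kernel (udiag n U d) \<subseteq> mat_kernel (udiag n W p)"
    and d: "\<And>j. j < n \<Longrightarrow> d j \<ge> 0"
    and h: "\<And>i. i < n \<Longrightarrow> p i = 0 \<Longrightarrow> h i = 0"
  shows "udiag n W h * udiag n U (\<lambda>j. supp_pow 0 (d j)) = udiag n W h" (is "?R * ?P = _")
    and "udiag n U (\<lambda>j. supp_pow 0 (d j)) * udiag n W h = udiag n W h"
proof -
  note u = unitary_matD[OF U] and w = unitary_matD[OF W]
  have "?R * ?P = ?R * udiag n U (\<lambda>_. 1)"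
  proof (rule udiag_mult_udiag_cong[OF W U])
    fix i j assume ij: "i < n" "j < n" "(adj W * U) $$ (i,j) \<noteq> 0"
    then have "p i = 0 \<or> d j > 0"
      using kernel_subset_overlap_zero[OF W U ker ij(1,2)] d[OF ij(2)] by force
    then show "h i * supp_pow 0 (d j) = h i * 1"
      using h ij by (auto simp: supp_pow_def)
  qed
  then show 1: "?R * ?P = ?R"
    using w by (simp add: udiag_one[OF U] right_mult_one_mat[of _ n n])
  have "?P * ?R = adj (?R * ?P)"
    using u w by (simp add: adj_mult_square[where n=n] adj_udiag)
  then show "?P * ?R = ?R"
    using 1 w by (simp add: adj_udiag)
qed

lemma mtrace_add:
  "A \<in> carrier_mat n n \<Longrightarrow> B \<in> carrier_mat n n \<Longrightarrow> mtrace (A + B) = mtrace A + mtrace B"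
  by (auto simp: mtrace_def sum.distrib)

theorem theorem1:
  fixes n :: nat and \<rho> \<sigma> :: "complex mat" and J :: "real set"
    and g g' :: "real \<Rightarrow> real"
  assumes "density_mat n \<rho>"
    and "psd_mat n \<sigma>"
    and "mat_kernel \<sigma> \<subseteq> mat_kernel \<rho>"
    and "open J" and "\<And>x y z. x \<in> J \<Longrightarrow> y \<in> J \<Longrightarrow> x \<le> z \<Longrightarrow> z \<le> y \<Longrightarrow> z \<in> J" and "1 \<in> J"
    and "\<And>x. x \<in> J \<Longrightarrow> (g has_real_derivative g' x) (at x)"
    and "continuous_on J g'"
    and "g 1 \<noteq> 0"
  shows "((\<lambda>\<alpha>. alpha_z_renyi n \<alpha> (g \<alpha>) \<rho> \<sigma>) \<longlongrightarrow> umegaki n \<rho> \<sigma>) (at 1)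
         \<and> umegaki n \<rho> \<sigma> = Re (mtrace (\<rho> * (mlog n \<rho> - mlog n \<sigma>)))"
proof -
  obtain U d where U: "unitary_mat n U" and \<sigma>: "\<sigma> = udiag n U d" and d: "\<And>i. i < n \<Longrightarrow> 0 \<le> d i"
    using psd_mat_udiag[OF assms(2)] by blast
  obtain W p where W: "unitary_mat n W" and \<rho>: "\<rho> = udiag n W p" and p: "\<And>i. i < n \<Longrightarrow> 0 \<le> p i"
    using psd_mat_udiag[of n \<rho>] assms(1) unfolding density_mat_def by blast
  note u = unitary_matD[OF U] and w = unitary_matD[OF W]
  have "complex_of_real (\<Sum>i<n. p i) = of_real 1"
    using assms(1) unfolding density_mat_def \<rho> mtrace_udiag[OF W] by simp
  then have p1: "(\<Sum>i<n. p i) = 1"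
    by (simp only: of_real_eq_iff)
  define z where "z = g 1"
  define g1 where "g1 = g' 1"
  have z: "z \<noteq> 0" and g: "(g has_real_derivative g1) (at 1)"
    using assms(6,7,9) by (auto simp: z_def g1_def)
  \<comment> \<open>\<open>\<sigma>\<close> enters on both sides of \<open>\<rho>\<close>, hence the
    factor 2 in its exponent.\<close>
  define s where "s t = (1 - t) / (2 * g t)" for t
  define r where "r t = t / g t" for t
  have s1: "s 1 = 0" and r1: "r 1 = 1 / z"
    by (simp_all add: s_def r_def z_def)
  have ds: "(s has_real_derivative - 1 / (2 * z)) (at 1)"
    unfolding s_def using z by (auto intro!: derivative_eq_intros g simp: z_def power2_eq_square)
  have dr: "(r has_real_derivative (z - g1) / z\<^sup>2) (at 1)"
    unfolding r_def using z by (auto intro!: derivative_eq_intros g simp: z_def power2_eq_square)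
  note dms = DERIV_minus[OF ds] and dmr = DERIV_minus[OF dr]
  define S where "S t = udiag n U (\<lambda>k. supp_pow (s t) (d k))" for t
  define R where "R t = udiag n W (\<lambda>k. supp_pow (r t) (p k))" for t
  define S' where "S' = udiag n U (\<lambda>k. - 1 / (2 * z) * (supp_pow (s 1) (d k) * supp_ln (d k)))"
  define R' where "R' = udiag n W (\<lambda>k. (z - g1) / z\<^sup>2 * (supp_pow (r 1) (p k) * supp_ln (p k)))"
  define P where "P = udiag n U (\<lambda>k. supp_pow 0 (d k))"
  \<comment> \<open>The power 0 taken on the support is a projection and in general not the
    identity; the kernel condition removes it next to functions of \<open>\<rho>\<close>.\<close>
  have S1: "S 1 = P"
    by (simp add: S_def P_def s1)
  have SR: "S t \<in> carrier_mat n n" "R t \<in> carrier_mat n n" "S' \<in> carrier_mat n n" "R' \<in> carrier_mat n n"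
      "P \<in> carrier_mat n n" for t
    unfolding S_def R_def S'_def R'_def P_def using u w by auto
  have absorb: "udiag n W h * P = udiag n W h" "P * udiag n W h = udiag n W h"
    if "\<And>i. p i = 0 \<Longrightarrow> h i = 0" for h
    unfolding P_def by (rule support_projection_absorb[OF W U assms(3)[unfolded \<sigma> \<rho>] d that]; assumption)+
  define M where "M t = S t * R t * S t" for t
  have dS: "has_mat_derivative n S S' 1"
    unfolding S_def S'_def by (intro has_mat_derivative_udiag u supp_pow_has_real_derivative ds)
  have dR: "has_mat_derivative n R R' 1"
    unfolding R_def R'_def by (intro has_mat_derivative_udiag w supp_pow_has_real_derivative dr)
  \<comment> \<open>The diagonals of \<open>R t\<close> and of \<open>R'\<close> both vanish
    wherever \<open>p\<close> does, as \<open>absorb\<close> demands.\<close>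
  have RP: "R t * P = R t" "P * R t = R t" "R' * P = R'" "P * R' = R'" for t
    unfolding R_def R'_def by (auto intro: absorb)
  have "has_mat_derivative n M ((S' * R 1 + S 1 * R') * S 1 + S 1 * R 1 * S') 1"
    unfolding M_def by (intro has_mat_derivative_mult dS dR)
  also have "(S' * R 1 + S 1 * R') * S 1 + S 1 * R 1 * S' = S' * R 1 + R' + R 1 * S'"
    using SR by (simp add: S1 RP add_mult_distrib_mat[of _ n n _ _ n] assoc_mult_mat_square[where n=n])
  finally have dM: "has_mat_derivative n M (S' * R 1 + R' + R 1 * S') 1" .
  define b where "b i = supp_pow (1 / z) (p i)" for i
  have M1: "M 1 = udiag n W b"
    unfolding M_def S1 RP unfolding R_def b_def r1 ..

  \<comment> \<open>Nonzero eigenvalues stay away from zero\<close>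
  define Si where "Si t = udiag n U (\<lambda>k. supp_pow (- s t) (d k))" for t
  define Ri where "Ri t = udiag n W (\<lambda>k. supp_pow (- r t) (p k))" for t
  define Q where "Q t = Si t * Ri t * Si t" for t
  have SRi: "Si t \<in> carrier_mat n n" "Ri t \<in> carrier_mat n n" "Q t \<in> carrier_mat n n" for t
    unfolding Si_def Ri_def Q_def using u w by auto
  have MQM: "M t * Q t * M t = M t" for t
  proof -
    have SSi: "S t * Si t = P" "Si t * S t = P"
      unfolding S_def Si_def P_def by (simp_all add: udiag_mult[OF U] supp_pow_mult)
    have RiP: "Ri t * P = Ri t"
      unfolding Ri_def by (auto intro: absorb)
    have RRR: "R t * Ri t * R t = R t"
      unfolding R_def Ri_def by (simp add: udiag_mult[OF W] supp_pow_mult)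
    \<comment> \<open>Regrouping lets each inner \<open>S t\<close> meet an \<open>Si t\<close>. The
      resulting copies of \<open>P\<close> are absorbed, and \<open>R t * Ri t * R t\<close>
      collapses to \<open>R t\<close>.\<close>
    have "M t * Q t * M t = S t * (R t * (S t * Si t) * (Ri t * (Si t * S t)) * R t) * S t"
      unfolding M_def Q_def using SR SRi by (simp add: assoc_mult_mat_square[where n=n])
    also have "\<dots> = M t"
      unfolding SSi RP RiP RRR M_def using SR by (simp add: assoc_mult_mat_square[where n=n])
    finally show ?thesis .
  qed
  have dSi: "has_mat_derivative n Si (udiag n U (\<lambda>k. - (- 1 / (2 * z)) * (supp_pow (- s 1) (d k) * supp_ln (d k)))) 1"
    unfolding Si_def by (intro has_mat_derivative_udiag u supp_pow_has_real_derivative dms)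
  have dRi: "has_mat_derivative n Ri (udiag n W (\<lambda>k. - ((z - g1) / z\<^sup>2) * (supp_pow (- r 1) (p k) * supp_ln (p k)))) 1"
    unfolding Ri_def by (intro has_mat_derivative_udiag w supp_pow_has_real_derivative dmr)
  \<comment> \<open>Differentiability is wanted here for continuity at 1, which keeps
    \<open>entry_norm n (Q t)\<close> bounded nearby.\<close>
  obtain Q' where Q': "has_mat_derivative n Q Q' 1"
    using has_mat_derivative_mult[OF has_mat_derivative_mult[OF dSi dRi] dSi] unfolding Q_def by blast
  define K where "K = entry_norm n (Q 1) + 1"
  have K: "K > 0"
    unfolding K_def using entry_norm_nonneg[of n "Q 1"] by simp
  have "\<forall>\<^sub>F t in at 1. entry_norm n (Q t) < K"
    using has_mat_derivative_entry_norm_tendsto[OF Q'] by (rule order_tendstoD) (simp add: K_def)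
  then have ev: "\<forall>\<^sub>F t in at 1. \<exists>V a. unitary_mat n V \<and> M t = udiag n V a \<and> (\<forall>j<n. a j = 0 \<or> 1 / K \<le> a j)"
  proof eventually_elim
    case (elim t)
    have adjS: "adj (S t) = S t" and adjR: "adj (R t) = R t"
      unfolding S_def R_def using u w by (simp_all add: adj_udiag)
    have "hermitian_mat n (M t)"
      unfolding hermitian_mat_def M_def using SR
      by (simp add: adj_mult_square[where n=n] adjS adjR assoc_mult_mat_square[where n=n])
    then obtain V a where V: "unitary_mat n V" and Mt: "M t = udiag n V a"
      using hermitian_mat_udiag by blast
    have "a j = 0 \<or> 1 / K \<le> a j" if j: "j < n" for j
    proof (cases "a j = 0")
      case False
      have "udiag n V a = S t * udiag n W (\<lambda>k. supp_pow (r t) (p k)) * adj (S t)"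
        using Mt by (simp add: adjS M_def R_def)
      then have "a j \<ge> 0"
        by (rule congruence_eigenvalue_nonneg[OF V SR(1) w(1) _ _ j]) simp
      moreover have "1 \<le> \<bar>a j\<bar> * entry_norm n (Q t)"
        using nonzero_eigenvalue_ge[OF V SRi(3)[of t], of a j] j False MQM[of t] Mt by simp
      moreover have "\<bar>a j\<bar> * entry_norm n (Q t) \<le> \<bar>a j\<bar> * K"
        using elim by (intro mult_left_mono) auto
      ultimately show ?thesis
        using K by (simp add: field_simps)
    qed simp
    then show ?case
      using V Mt by blast
  qed

  \<comment> \<open>Evaluation of the derivative at 1\<close>
  define T where "T t = Re (mtrace (mpow n (M t) (g t)))" for t
  \<comment> \<open>\<open>G\<close> is the derivative of the power with exponent \<open>z\<close>,
    evaluated at \<open>M 1\<close>. The numbers \<open>ent\<close> and \<open>cross\<close> are the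
    traces of \<open>\<rho>\<close> times the logarithm of \<open>\<rho>\<close> and of
    \<open>\<sigma>\<close>, taken on supports.\<close>
  define G where "G = udiag n W (\<lambda>i. z * supp_pow (z - 1) (b i))"
  define ent where "ent = (\<Sum>i<n. p i * supp_ln (p i))"
  define cross where "cross = Re (mtrace (udiag n W p * udiag n U (\<lambda>k. supp_ln (d k))))"
  have "(T has_real_derivative g1 * (\<Sum>i<n. supp_pow z (b i) * supp_ln (b i))
      + Re (mtrace (G * (S' * R 1 + R' + R 1 * S')))) (at 1)"
    unfolding T_def G_def z_def
    by (rule mtrace_mpow_has_derivative[OF dM W M1 _ _ ev g]) (use K in \<open>auto simp: b_def\<close>)
  \<comment> \<open>As \<open>b i\<close> is \<open>p i\<close> to the power \<open>1 / z\<close>,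
    the outer power restores \<open>p i\<close> and the logarithm gains the factor
    \<open>1 / z\<close>.\<close>
  moreover have "(\<Sum>i<n. supp_pow z (b i) * supp_ln (b i)) = ent / z"
    unfolding ent_def b_def sum_divide_distrib using z p
    by (intro sum.cong refl) (simp add: supp_pow_supp_pow supp_ln_supp_pow supp_pow_1)
  moreover have "Re (mtrace (G * (S' * R 1 + R' + R 1 * S'))) = (1 - g1 / z) * ent - cross"
  proof -
    have G: "G \<in> carrier_mat n n"
      unfolding G_def using w by simp
    have bp: "z * supp_pow (z - 1) (b i) * supp_pow (1 / z) (p i) = z * p i" if "i < n" for i
    proof -
      have "1 / z * (z - 1) + 1 / z = 1" using z by (simp add: field_simps)
      then show ?thesis
        using p[OF that] by (simp add: b_def supp_pow_supp_pow supp_pow_mult mult.assoc supp_pow_1)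
    qed
    have GR: "G * R 1 = udiag n W (\<lambda>i. z * p i)" "R 1 * G = udiag n W (\<lambda>i. z * p i)"
      unfolding G_def R_def udiag_mult[OF W] r1
      by (auto intro!: udiag_cong simp: bp[symmetric] mult.commute)
    have GR': "G * R' = udiag n W (\<lambda>i. (z - g1) / z * (p i * supp_ln (p i)))"
      unfolding G_def R'_def udiag_mult[OF W] r1
    proof (intro udiag_cong)
      fix i assume "i < n"
      then show "z * supp_pow (z - 1) (b i) * ((z - g1) / z\<^sup>2 * (supp_pow (1 / z) (p i) * supp_ln (p i)))
          = (z - g1) / z * (p i * supp_ln (p i))"
        using arg_cong[OF bp, of i "\<lambda>y. (z - g1) / z\<^sup>2 * y * supp_ln (p i)"] z
        by (simp add: power2_eq_square ac_simps)
    qed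
    \<comment> \<open>Cyclicity and \<open>GR\<close> bring both terms containing \<open>S'\<close>
      to the same trace of \<open>z\<close> times \<open>\<rho>\<close> against
      \<open>S'\<close>.\<close>
    have "mtrace (G * (S' * R 1 + R' + R 1 * S')) =
        mtrace (G * (S' * R 1)) + mtrace (G * R') + mtrace (G * (R 1 * S'))"
      using SR G by (simp add: mult_add_distrib_mat[of _ n n _ n] mtrace_add[of _ n])
    also have "mtrace (G * (S' * R 1)) = mtrace ((G * S') * R 1)"
      using SR G by (simp add: assoc_mult_mat_square[where n=n])
    also have "\<dots> = mtrace (R 1 * (G * S'))"
      using SR G by (intro mtrace_comm[of _ n]) auto
    also have "R 1 * (G * S') = (R 1 * G) * S'"
      using SR G by (simp add: assoc_mult_mat_square[where n=n])
    also have "G * (R 1 * S') = (G * R 1) * S'"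
      using SR G by (simp add: assoc_mult_mat_square[where n=n])
    finally have "Re (mtrace (G * (S' * R 1 + R' + R 1 * S'))) =
        2 * Re (mtrace (udiag n W (\<lambda>i. z * p i) * S')) + Re (mtrace (G * R'))"
      unfolding GR by simp
    moreover have "Re (mtrace (udiag n W (\<lambda>i. z * p i) * S')) = - cross / 2"
    proof -
      \<comment> \<open>Since \<open>s 1 = 0\<close>, the power is the indicator of the support,
        outside of which \<open>supp_ln\<close> is zero anyway.\<close>
      have eq: "z * p i * (- 1 / (2 * z) * (supp_pow (s 1) (d j) * supp_ln (d j))) = (- 1 / 2) * (p i * supp_ln (d j))"
        for i j
        using z by (simp add: s1 supp_pow_def supp_ln_def)
      show ?thesis
        unfolding S'_def cross_def mtrace_udiag_mult_udiag[OF W U] eq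
        by (simp add: sum_distrib_left sum_negf[symmetric] sum_divide_distrib)
    qed
    moreover have "Re (mtrace (G * R')) = (1 - g1 / z) * ent"
      unfolding GR' mtrace_udiag[OF W] ent_def using z
      by (simp add: sum_distrib_left[symmetric] diff_divide_distrib)
    ultimately show ?thesis by simp
  qed
  \<comment> \<open>The contribution \<open>g1 * (ent / z)\<close> of the varying outer exponent
    cancels the term \<open>- g1 / z * ent\<close> coming from \<open>R'\<close>.\<close>
  ultimately have dT: "(T has_real_derivative ent - cross) (at 1)"
    by (simp add: algebra_simps)
  have T1: "T 1 = 1"
  proof -
    have "T 1 = (\<Sum>i<n. supp_pow z (b i))"
      unfolding T_def M1 mpow_def mat_fun_udiag[OF W] mtrace_udiag[OF W] z_def by simp
    also have "\<dots> = (\<Sum>i<n. p i)"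
      using z p by (intro sum.cong) (auto simp: b_def supp_pow_supp_pow supp_pow_1)
    finally show ?thesis
      by (simp add: p1)
  qed
  \<comment> \<open>As \<open>T 1 = 1\<close>, the logarithm vanishes at 1, so the entropy is
    exactly the difference quotient of \<open>ln (T t)\<close> there.\<close>
  have "((\<lambda>t. ln (T t)) has_real_derivative 1 / T 1 * (ent - cross)) (at 1)"
    using dT T1 by (intro derivative_eq_intros) auto
  then have lim: "((\<lambda>t. ln (T t) / (t - 1)) \<longlongrightarrow> ent - cross) (at 1)"
    by (simp add: has_field_derivative_iff T1)
  have renyi: "alpha_z_renyi n t (g t) \<rho> \<sigma> = ln (T t) / (t - 1)" for t
    unfolding alpha_z_renyi_def T_def M_def S_def R_def s_def r_def mpow_def[of n \<sigma>] mpow_def[of n \<rho>]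
    unfolding \<rho> \<sigma> mat_fun_udiag[OF U] mat_fun_udiag[OF W] by simp
  have "umegaki n \<rho> \<sigma> = Re (mtrace (\<rho> * mlog n \<rho> - \<rho> * mlog n \<sigma>))"
    unfolding umegaki_def mlog_def \<rho> \<sigma> mat_fun_udiag[OF U] mat_fun_udiag[OF W]
    using u w by (simp add: mult_minus_distrib_mat[of _ n n _ n])
  also have "\<dots> = ent - cross"
    unfolding ent_def cross_def mlog_def \<rho> \<sigma> mat_fun_udiag[OF U] mat_fun_udiag[OF W] udiag_mult[OF W]
    using u w by (simp add: mtrace_minus[of _ n] mtrace_udiag[OF W])
  finally show ?thesis
    using lim by (simp add: renyi umegaki_def)
qed

end
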